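(* Let $X,Y$ be complex Banach spaces, let $\alpha,\beta\in(0,1]$, let $\varphi:\mathbb{D}\to\mathbb{D}$ be analytic and let $\psi:\mathbb{D}\to L(X,Y)$ be analytic. Suppose that $W_{\psi,\varphi}:\Lambda_\alpha(X)\to\Lambda_\beta(Y)$ is (well defined and) bounded, that $\psi\in\Lambda_\beta^0(L(X,Y))$, and that $$\lim_{|z|\to1^-}(1-|z|^2)^{1-\beta}\varphi'(z)\psi_z=0$$ (in the operator norm of $L(X,Y)$). Then $W_{\psi,\varphi}:\Lambda_\alpha^0(X)\to\Lambda_\beta^0(Y)$ is well defined and bounded.
   Context: $\mathbb{D}$ is the open unit disk of $\mathbb{C}$. $L(X,Y)$ is the Banach space of bounded linear operators $X\to Y$ with the operator norm. For a complex Banach space $X$, $H(\mathbb{D},X)$ is the space of analytic functions $\mathbb{D}\to X$. For $\alpha\in(0,1]$, $\Lambda_\alpha(X)$ is the space of all $f\in H(\mathbb{D},X)$ with $p_\alpha(f)=\sup_{z\ne w\in\mathbb{D}}\|f(z)-f(w)\|/|z-w|^\alpha<\infty$. It is a Banach space under $\|f\|_\alpha=\sup_{z\in\mathbb{D}}\|f(z)\|+p_\alpha(f)$; for $\alpha\in(0,1)$ an equivalent norm is $\|f\|_{\Lambda_\alpha(X)}=\|f(0)\|+\sup_{z\in\mathbb{D}}(1-|z|^2)^{1-\alpha}\|f'(z)\|$. $\Lambda_\alpha^0(X)$ is the closed subspace of those $f\in\Lambda_\alpha(X)$ with $\lim_{|z-w|\to0}\|f(z)-f(w)\|/|z-w|^\alpha=0$.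 The same definitions apply with $X$ replaced by $Y$ or $L(X,Y)$ and $\alpha$ by $\beta$. Write $\psi_z=\psi(z)\in L(X,Y)$. The weighted composition operator is $W_{\psi,\varphi}(f)(z)=\psi_z(f(\varphi(z)))$, $z\in\mathbb{D}$, for $f:\mathbb{D}\to X$. *)

theory Defs
  imports "HOL-Complex_Analysis.Complex_Analysis"
begin

section \<open>Complex Banach spaces\<close>

class complex_normed_vector = real_normed_vector +
  fixes scaleC :: "complex \<Rightarrow> 'a \<Rightarrow> 'a"  (infixr "*\<^sub>C" 75)
  assumes scaleC_add_right: "c *\<^sub>C (x + y) = c *\<^sub>C x + c *\<^sub>C y"
    and scaleC_add_left: "(c + d) *\<^sub>C x = c *\<^sub>C x + d *\<^sub>C x"
    and scaleC_scaleC: "c *\<^sub>C (d *\<^sub>C x) = (c * d) *\<^sub>C x"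
    and scaleC_of_real: "complex_of_real r *\<^sub>C x = r *\<^sub>R x"
    and norm_scaleC: "norm (c *\<^sub>C x) = cmod c * norm x"

class complex_banach = complex_normed_vector + banach

instantiation complex :: complex_banach
begin

definition scaleC_complex :: "complex \<Rightarrow> complex \<Rightarrow> complex" where
  "scaleC_complex c x = c * x"

instance
  by standard (auto simp: scaleC_complex_def algebra_simps norm_mult scaleR_conv_of_real)

end

lemma bounded_linear_scaleC_right: "bounded_linear (\<lambda>x::'a::complex_normed_vector. c *\<^sub>C x)"
proof (rule bounded_linear_intro[where K = "cmod c"])
  show "c *\<^sub>C (r *\<^sub>R x) = r *\<^sub>R (c *\<^sub>C x)" for r and x :: 'a
    by (metis scaleC_of_real scaleC_scaleC mult.commute)
qed (simp_all add: scaleC_add_right norm_scaleC mult.commute)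

lemma bounded_linear_scaleC_left: "bounded_linear (\<lambda>c. c *\<^sub>C (x::'a::complex_normed_vector))"
proof (rule bounded_linear_intro[where K = "norm x"])
  show "(r *\<^sub>R c) *\<^sub>C x = r *\<^sub>R (c *\<^sub>C x)" for r and c :: complex
    by (metis scaleC_of_real scaleC_scaleC scaleR_conv_of_real)
qed (simp_all add: scaleC_add_left norm_scaleC)

lemma scaleC_zero_right: "c *\<^sub>C (0::'a::complex_normed_vector) = 0"
  by (rule linear_simps(3)[OF bounded_linear_scaleC_right])

lemma bounded_linear_scaleC_blinfun:
  "bounded_linear (\<lambda>x. c *\<^sub>C blinfun_apply T (x::'a::real_normed_vector))"
  by (rule bounded_linear_compose[OF bounded_linear_scaleC_right blinfun.bounded_linear_right])

section \<open>The Banach space of bounded complex-linear operators\<close>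

text \<open>The library type of bounded operators \<open>'a \<Rightarrow>\<^sub>L 'b\<close> contains all bounded real-linear maps;
  its complex-linear elements form a closed subspace, whose norm is the operator norm.\<close>

typedef (overloaded) ('a::complex_normed_vector, 'b::complex_normed_vector) clinop =
  "{T :: 'a \<Rightarrow>\<^sub>L 'b. \<forall>c x. blinfun_apply T (c *\<^sub>C x) = c *\<^sub>C blinfun_apply T x}"
  morphisms blinfun_of_clinop clinop_of_blinfun
  by (rule exI[of _ 0]) (simp add: scaleC_zero_right)

setup_lifting type_definition_clinop

lemma blinfun_of_clinop_scaleC:
  "blinfun_apply (blinfun_of_clinop T) (c *\<^sub>C x) = c *\<^sub>C blinfun_apply (blinfun_of_clinop T) x"
  using blinfun_of_clinop[of T] by simp

lift_definition clinop_apply ::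
  "('a::complex_normed_vector, 'b::complex_normed_vector) clinop \<Rightarrow> 'a \<Rightarrow> 'b"
  is blinfun_apply .

instantiation clinop :: (complex_normed_vector, complex_normed_vector) complex_normed_vector
begin

lift_definition zero_clinop :: "('a, 'b) clinop" is 0
  by (simp add: scaleC_zero_right)

lift_definition plus_clinop :: "('a, 'b) clinop \<Rightarrow> ('a, 'b) clinop \<Rightarrow> ('a, 'b) clinop" is "(+)"
  by (simp add: plus_blinfun.rep_eq scaleC_add_right)

lift_definition minus_clinop :: "('a, 'b) clinop \<Rightarrow> ('a, 'b) clinop \<Rightarrow> ('a, 'b) clinop" is "(-)"
  by (simp add: minus_blinfun.rep_eq bounded_linear_scaleC_right linear_simps(2))

lift_definition uminus_clinop :: "('a, 'b) clinop \<Rightarrow> ('a, 'b) clinop" is uminus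
  by (simp add: uminus_blinfun.rep_eq bounded_linear_scaleC_right linear_simps(4))

lift_definition scaleR_clinop :: "real \<Rightarrow> ('a, 'b) clinop \<Rightarrow> ('a, 'b) clinop" is scaleR
  by (simp add: scaleR_blinfun.rep_eq bounded_linear_scaleC_right linear_simps(5))

lift_definition scaleC_clinop :: "complex \<Rightarrow> ('a, 'b) clinop \<Rightarrow> ('a, 'b) clinop"
  is "\<lambda>c T. Blinfun (\<lambda>x. c *\<^sub>C blinfun_apply T x)"
  by (simp add: bounded_linear_Blinfun_apply bounded_linear_scaleC_blinfun scaleC_scaleC mult.commute)

lift_definition norm_clinop :: "('a, 'b) clinop \<Rightarrow> real" is norm .

definition dist_clinop :: "('a, 'b) clinop \<Rightarrow> ('a, 'b) clinop \<Rightarrow> real" where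
  "dist_clinop S T = norm (S - T)"

definition sgn_clinop :: "('a, 'b) clinop \<Rightarrow> ('a, 'b) clinop" where
  "sgn_clinop T = inverse (norm T) *\<^sub>R T"

definition uniformity_clinop :: "(('a, 'b) clinop \<times> ('a, 'b) clinop) filter" where
  "uniformity_clinop = (INF e\<in>{0<..}. principal {(S, T). dist S T < e})"

definition open_clinop :: "('a, 'b) clinop set \<Rightarrow> bool" where
  "open_clinop U = (\<forall>S\<in>U. \<forall>\<^sub>F (S', T) in uniformity. S' = S \<longrightarrow> T \<in> U)"

lemma scaleC_clinop_rep:
  "blinfun_apply (blinfun_of_clinop (c *\<^sub>C T)) x = c *\<^sub>C blinfun_apply (blinfun_of_clinop T) x"
  for T :: "('a, 'b) clinop"
  by (simp add: scaleC_clinop.rep_eq bounded_linear_Blinfun_apply bounded_linear_scaleC_blinfun)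

instance
proof
  fix c d :: complex and r s :: real and S T U :: "('a, 'b) clinop"
  note eqI = blinfun_of_clinop_inject[THEN iffD1, OF blinfun_eqI]
  show "S + T + U = S + (T + U)" "S + T = T + S" "0 + S = S" "- S + S = 0" "S - T = S + - T"
    by (transfer; simp)+
  show "r *\<^sub>R (S + T) = r *\<^sub>R S + r *\<^sub>R T" "(r + s) *\<^sub>R S = r *\<^sub>R S + s *\<^sub>R S"
    "r *\<^sub>R s *\<^sub>R S = (r * s) *\<^sub>R S" "1 *\<^sub>R S = S"
    by (transfer; simp add: algebra_simps)+
  show "dist S T = norm (S - T)" by (rule dist_clinop_def)
  show "sgn S = inverse (norm S) *\<^sub>R S" by (rule sgn_clinop_def)
  show "uniformity = (INF e\<in>{0<..}. principal {(S, T::('a, 'b) clinop). dist S T < e})"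
    by (rule uniformity_clinop_def)
  show "open V = (\<forall>S\<in>V. \<forall>\<^sub>F (S', T) in uniformity. S' = S \<longrightarrow> T \<in> V)" for V :: "('a, 'b) clinop set"
    by (rule open_clinop_def)
  show "(norm S = 0) = (S = 0)" "norm (r *\<^sub>R S) = \<bar>r\<bar> * norm S"
    by (transfer; simp)+
  show "norm (S + T) \<le> norm S + norm T" by transfer (rule norm_triangle_ineq)
  show "c *\<^sub>C (S + T) = c *\<^sub>C S + c *\<^sub>C T" "(c + d) *\<^sub>C S = c *\<^sub>C S + d *\<^sub>C S"
    "c *\<^sub>C d *\<^sub>C S = (c * d) *\<^sub>C S" "complex_of_real r *\<^sub>C S = r *\<^sub>R S"
    by (rule eqI; simp add: scaleC_clinop_rep plus_clinop.rep_eq scaleR_clinop.rep_eq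
        plus_blinfun.rep_eq scaleR_blinfun.rep_eq
        scaleC_add_left scaleC_add_right scaleC_scaleC scaleC_of_real)+
  have le: "norm (c *\<^sub>C S) \<le> cmod c * norm S" for c and S :: "('a, 'b) clinop"
    unfolding norm_clinop.rep_eq
  proof (rule norm_blinfun_bound)
    show "norm (blinfun_apply (blinfun_of_clinop (c *\<^sub>C S)) x)
        \<le> cmod c * norm (blinfun_of_clinop S) * norm x" for x
      by (simp add: scaleC_clinop_rep norm_scaleC mult.assoc mult_left_mono norm_blinfun)
  qed simp
  show "norm (c *\<^sub>C S) = cmod c * norm S"
  proof (cases "c = 0")
    case True
    then show ?thesis using le[of c S] by (simp add: norm_clinop.rep_eq)
  next
    case False
    then have "inverse c *\<^sub>C c *\<^sub>C S = S"
      by (intro eqI) (use scaleC_of_real[of 1] in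
          \<open>simp add: scaleC_clinop_rep scaleC_scaleC\<close>)
    then have "norm S \<le> cmod (inverse c) * norm (c *\<^sub>C S)"
      using le[of "inverse c" "c *\<^sub>C S"] by simp
    with False have "cmod c * norm S \<le> norm (c *\<^sub>C S)"
      by (simp add: norm_inverse norm_divide field_simps)
    with le[of c S] show ?thesis by simp
  qed
qed

end

lemma norm_clinop_apply: "norm (clinop_apply T x) \<le> norm T * norm x"
  by transfer (rule norm_blinfun)

instance clinop :: (complex_normed_vector, complex_banach) complex_banach
proof
  fix T :: "nat \<Rightarrow> ('a, 'b) clinop"
  assume "Cauchy T"
  have d: "dist (blinfun_of_clinop A) (blinfun_of_clinop B) = dist A B" for A B :: "('a, 'b) clinop"
    by (simp add: dist_norm norm_clinop.rep_eq minus_clinop.rep_eq)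
  have "Cauchy (\<lambda>n. blinfun_of_clinop (T n))"
    using \<open>Cauchy T\<close> by (simp add: Cauchy_def d)
  then obtain L where L: "(\<lambda>n. blinfun_of_clinop (T n)) \<longlonglongrightarrow> L"
    using Cauchy_convergent_iff convergent_def by blast
  have lim: "(\<lambda>n. blinfun_apply (blinfun_of_clinop (T n)) x) \<longlonglongrightarrow> blinfun_apply L x" for x
    by (intro tendsto_intros L)
  have "blinfun_apply L (c *\<^sub>C x) = c *\<^sub>C blinfun_apply L x" for c x
  proof (rule LIMSEQ_unique[OF lim])
    have "(\<lambda>n. c *\<^sub>C blinfun_apply (blinfun_of_clinop (T n)) x) \<longlonglongrightarrow> c *\<^sub>C blinfun_apply L x"
      by (rule bounded_linear.tendsto[OF bounded_linear_scaleC_right lim])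
    then show "(\<lambda>n. blinfun_apply (blinfun_of_clinop (T n)) (c *\<^sub>C x)) \<longlonglongrightarrow> c *\<^sub>C blinfun_apply L x"
      by (simp add: blinfun_of_clinop_scaleC)
  qed
  then have "blinfun_of_clinop (clinop_of_blinfun L) = L"
    by (simp add: clinop_of_blinfun_inverse)
  then have "T \<longlonglongrightarrow> clinop_of_blinfun L"
    using L by (simp add: tendsto_iff flip: d)
  then show "convergent T" by (auto simp: convergent_def)
qed

section \<open>Analytic Lipschitz spaces on the unit disk\<close>

text \<open>Functions on the disk are represented by total functions on \<^typ>\<open>complex\<close>; none of the
  notions below depends on the values outside \<open>ball 0 1\<close>.\<close>

definition disk_analytic :: "(complex \<Rightarrow> 'a::complex_normed_vector) \<Rightarrow> bool" where
  "disk_analytic f \<longleftrightarrow> (\<forall>z\<in>ball 0 1. \<exists>d. (f has_derivative (\<lambda>h. h *\<^sub>C d)) (at z))"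

definition lip_quot :: "real \<Rightarrow> (complex \<Rightarrow> 'a::real_normed_vector) \<Rightarrow> complex \<times> complex \<Rightarrow> real" where
  "lip_quot \<alpha> f = (\<lambda>(z, w). norm (f z - f w) / cmod (z - w) powr \<alpha>)"

definition off_diag :: "(complex \<times> complex) set" where
  "off_diag = {(z, w). z \<in> ball 0 1 \<and> w \<in> ball 0 1 \<and> z \<noteq> w}"

definition lip_space :: "real \<Rightarrow> (complex \<Rightarrow> 'a::complex_normed_vector) set" where
  "lip_space \<alpha> = {f. disk_analytic f \<and> bdd_above (lip_quot \<alpha> f ` off_diag)}"

text \<open>On \<^const>\<open>lip_space\<close> both suprema are over bounded sets, so the real-valued suprema
  are the genuine ones there.\<close>

definition lip_norm :: "real \<Rightarrow> (complex \<Rightarrow> 'a::complex_normed_vector) \<Rightarrow> real" where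
  "lip_norm \<alpha> f = (SUP z\<in>ball 0 1. norm (f z)) + (SUP p\<in>off_diag. lip_quot \<alpha> f p)"

definition little_lip_space :: "real \<Rightarrow> (complex \<Rightarrow> 'a::complex_normed_vector) set" where
  "little_lip_space \<alpha> = {f \<in> lip_space \<alpha>.
     (lip_quot \<alpha> f \<longlongrightarrow> 0)
       (inf (filtercomap (\<lambda>(z, w). cmod (z - w)) (at_right 0)) (principal off_diag))}"

section \<open>Weighted composition operators\<close>

definition wcomp ::
  "(complex \<Rightarrow> ('a::complex_normed_vector, 'b::complex_normed_vector) clinop) \<Rightarrow>
   (complex \<Rightarrow> complex) \<Rightarrow> (complex \<Rightarrow> 'a) \<Rightarrow> complex \<Rightarrow> 'b" where
  "wcomp \<psi> \<phi> f = (\<lambda>z. clinop_apply (\<psi> z) (f (\<phi> z)))"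

text \<open>\<open>T\<close> maps \<open>A\<close> into \<open>B\<close> and is bounded for the \<open>\<Lambda>\<^sub>\<alpha>\<close> norm on \<open>A\<close> and the \<open>\<Lambda>\<^sub>\<beta>\<close> norm on \<open>B\<close>.
  Linearity is not required here, since \<^const>\<open>wcomp\<close> is linear by construction.\<close>

definition bounded_op ::
  "real \<Rightarrow> (complex \<Rightarrow> 'a::complex_normed_vector) set \<Rightarrow>
   real \<Rightarrow> (complex \<Rightarrow> 'b::complex_normed_vector) set \<Rightarrow>
   ((complex \<Rightarrow> 'a) \<Rightarrow> complex \<Rightarrow> 'b) \<Rightarrow> bool" where
  "bounded_op \<alpha> A \<beta> B T \<longleftrightarrow>
     T ` A \<subseteq> B \<and> (\<exists>C. \<forall>f\<in>A. lip_norm \<beta> (T f) \<le> C * lip_norm \<alpha> f)"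

end

theory Submission
  imports Defs
begin

text \<open>
  Since \<open>\<Lambda>\<^sub>\<alpha>\<^sup>0\<close> lies in \<open>\<Lambda>\<^sub>\<alpha>\<close>, boundedness is inherited, and only one thing has to be proved:
  \<open>W f\<close> lies in \<open>\<Lambda>\<^sub>\<beta>\<^sup>0\<close> whenever \<open>f\<close> lies in \<open>\<Lambda>\<^sub>\<alpha>\<^sup>0\<close>. This is done by approximation. A function
  \<open>f\<close> in \<open>\<Lambda>\<^sub>\<alpha>\<^sup>0\<close> is the norm limit of its dilations \<open>f (r z)\<close>, \<open>r \<longlonglongrightarrow> 1\<close>
  (\<open>little_lip_dilation_approx\<close>), and \<open>W\<close> is bounded on the big space, so up to a uniformly small
  multiple of \<open>\<bar>z - w\<bar>\<^sup>\<beta>\<close> the increments of \<open>W f\<close> are those of \<open>W g\<close> with \<open>g\<close> a dilation.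
  The gain is that \<open>g\<close> is Lipschitz on the whole disk (\<open>disk_analytic_dilation_lipschitz\<close>): composed
  with functionals, this is the classical Cauchy estimate, and the complex Hahn-Banach theorem
  transfers it to vector-valued functions.

  For a bounded Lipschitz \<open>g\<close>,
  \<open>W g z - W g w = (\<psi> z - \<psi> w) (g (\<phi> z)) + \<psi> w (g (\<phi> z) - g (\<phi> w))\<close>. The first term is small because
  \<open>\<psi>\<close> is in the little space. The second is at most a constant times \<open>\<parallel>\<psi> w\<parallel> \<bar>\<phi> z - \<phi> w\<bar>\<close>, and the
  heart of the proof is that this is \<open>o(\<bar>z - w\<bar>\<^sup>\<beta>)\<close> (\<open>multiplier_times_symbol_difference\<close>). With
  \<open>d = \<bar>z - w\<bar>\<close>, either \<open>\<parallel>\<psi> w\<parallel>\<close> is at most \<open>\<eta> d\<^sup>\<beta>\<close>, and \<open>\<bar>\<phi> z - \<phi> w\<bar> \<le> 2\<close> suffices; or \<open>\<psi>\<close> varies so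
  little near \<open>w\<close> that \<open>\<parallel>\<psi> \<zeta>\<parallel> \<ge> \<parallel>\<psi> w\<parallel> / 2\<close> for \<open>\<bar>\<zeta> - w\<bar> \<le> 2 d\<close>. In the second case the
  boundary condition on \<open>\<phi>' \<psi>\<close> becomes a bound for \<open>\<phi>'\<close> alone near \<open>w\<close>, which a local form of the
  Hardy-Littlewood theorem integrates along a curve from \<open>w\<close> to \<open>z\<close>. In this way neither the
  derivative of \<open>\<psi>\<close> nor that of \<open>f\<close> is ever estimated.
\<close>

section \<open>Norming functionals\<close>

definition sublinear :: "('a::real_vector \<Rightarrow> real) \<Rightarrow> bool" where
  "sublinear p \<longleftrightarrow> (\<forall>x y. p (x + y) \<le> p x + p y) \<and> (\<forall>c x. 0 \<le> c \<longrightarrow> p (c *\<^sub>R x) \<le> c * p x)"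

lemma sublinear_add: "sublinear p \<Longrightarrow> p (x + y) \<le> p x + p y"
  by (simp add: sublinear_def)

lemma sublinear_scale: "sublinear p \<Longrightarrow> 0 \<le> c \<Longrightarrow> p (c *\<^sub>R x) \<le> c * p x"
  by (simp add: sublinear_def)

lemma sublinear_minus: "sublinear p \<Longrightarrow> - p (- x) \<le> p x"
  using sublinear_add[of p x "- x"] sublinear_add[of p 0 0] by simp

text \<open>The largest sublinear \<open>p' \<le> p\<close> with \<open>p' (- a) \<le> - p a\<close>: lowering \<open>p\<close> this way is what
  forces a minimal sublinear functional to be additive, and started from the norm it makes that
  functional norming at \<open>a\<close>.\<close>

definition sublinear_shift :: "('a::real_vector \<Rightarrow> real) \<Rightarrow> 'a \<Rightarrow> 'a \<Rightarrow> real" where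
  "sublinear_shift p a x = (INF t\<in>{0..}. p (x + t *\<^sub>R a) - t * p a)"

lemma sublinear_shift_lower:
  assumes p: "sublinear p" and t: "0 \<le> t"
  shows "- p (- x) \<le> p (x + t *\<^sub>R a) - t * p a"
proof -
  have "p (x + t *\<^sub>R a) + p (- x) \<ge> p (t *\<^sub>R a)"
    using sublinear_add[OF p, of "x + t *\<^sub>R a" "- x"] by simp
  moreover have "t * p a \<le> p (t *\<^sub>R a)"
  proof (cases "t = 0")
    case True
    then show ?thesis using sublinear_add[OF p, of 0 0] by simp
  next
    case False
    then have "p a \<le> inverse t * p (t *\<^sub>R a)"
      using sublinear_scale[OF p, of "inverse t" "t *\<^sub>R a"] t by simp
    then show ?thesis using False t by (simp add: field_simps)
  qed
  ultimately show ?thesis by simp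
qed

lemma sublinear_shift_le:
  assumes p: "sublinear p" and t: "0 \<le> t"
  shows "sublinear_shift p a x \<le> p (x + t *\<^sub>R a) - t * p a"
  unfolding sublinear_shift_def
proof (rule cINF_lower)
  show "bdd_below ((\<lambda>t. p (x + t *\<^sub>R a) - t * p a) ` {0..})"
    by (rule bdd_belowI2[where m = "- p (- x)"]) (simp add: sublinear_shift_lower[OF p])
qed (use t in simp)

lemma sublinear_shift_greatest:
  assumes "\<And>t. 0 \<le> t \<Longrightarrow> m \<le> p (x + t *\<^sub>R a) - t * p a"
  shows "m \<le> sublinear_shift p a x"
  unfolding sublinear_shift_def by (rule cINF_greatest) (use assms in auto)

lemma sublinear_sublinear_shift:
  assumes p: "sublinear p"
  shows "sublinear (sublinear_shift p a)"
  unfolding sublinear_def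
proof safe
  fix x y
  have "sublinear_shift p a (x + y) - (p (y + t *\<^sub>R a) - t * p a) \<le> sublinear_shift p a x"
    if t: "0 \<le> t" for t
  proof (rule sublinear_shift_greatest)
    fix s :: real assume s: "0 \<le> s"
    have "sublinear_shift p a (x + y) \<le> p ((x + y) + (s + t) *\<^sub>R a) - (s + t) * p a"
      using s t by (intro sublinear_shift_le[OF p]) simp
    moreover have "p ((x + y) + (s + t) *\<^sub>R a) \<le> p (x + s *\<^sub>R a) + p (y + t *\<^sub>R a)"
      using sublinear_add[OF p, of "x + s *\<^sub>R a" "y + t *\<^sub>R a"] by (simp add: algebra_simps)
    ultimately show "sublinear_shift p a (x + y) - (p (y + t *\<^sub>R a) - t * p a)
        \<le> p (x + s *\<^sub>R a) - s * p a"
      by (simp add: algebra_simps)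
  qed
  then have "sublinear_shift p a (x + y) - sublinear_shift p a x \<le> sublinear_shift p a y"
    by (intro sublinear_shift_greatest) (simp add: algebra_simps)
  then show "sublinear_shift p a (x + y) \<le> sublinear_shift p a x + sublinear_shift p a y"
    by simp
next
  fix c :: real and x assume c: "0 \<le> c"
  show "sublinear_shift p a (c *\<^sub>R x) \<le> c * sublinear_shift p a x"
  proof (cases "c = 0")
    case True
    then show ?thesis
      using sublinear_shift_le[OF p, of 0 a 0] sublinear_scale[OF p, of 0 0] by simp
  next
    case False
    have "inverse c * sublinear_shift p a (c *\<^sub>R x) \<le> sublinear_shift p a x"
    proof (rule sublinear_shift_greatest)
      fix t :: real assume t: "0 \<le> t"
      have "sublinear_shift p a (c *\<^sub>R x) \<le> p (c *\<^sub>R x + (c * t) *\<^sub>R a) - (c * t) * p a"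
        using c t by (intro sublinear_shift_le[OF p]) simp
      also have "p (c *\<^sub>R x + (c * t) *\<^sub>R a) \<le> c * p (x + t *\<^sub>R a)"
        using sublinear_scale[OF p c, of "x + t *\<^sub>R a"] by (simp add: algebra_simps)
      finally have "sublinear_shift p a (c *\<^sub>R x) \<le> c * (p (x + t *\<^sub>R a) - t * p a)"
        by (simp add: algebra_simps)
      then show "inverse c * sublinear_shift p a (c *\<^sub>R x) \<le> p (x + t *\<^sub>R a) - t * p a"
        using False c by (simp add: field_simps)
    qed
    then show ?thesis using False c by (simp add: field_simps)
  qed
qed

lemma sublinear_shift_le_self: "sublinear p \<Longrightarrow> sublinear_shift p a x \<le> p x"
  using sublinear_shift_le[of p 0 a x] by simp

text \<open>A chain of sublinear functionals has a sublinear infimum, because of any two members the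
  smaller serves both summands of \<open>x + y\<close>. The common bound \<open>q\<close> keeps the infimum finite, since
  \<open>p x \<ge> - p (- x) \<ge> - q (- x)\<close>.\<close>

lemma sublinear_chain_INF:
  fixes C :: "('a::real_vector \<Rightarrow> real) set"
  assumes sub: "\<And>p. p \<in> C \<Longrightarrow> sublinear p" and le: "\<And>p. p \<in> C \<Longrightarrow> p \<le> q"
    and ne: "C \<noteq> {}" and chain: "\<And>p p'. p \<in> C \<Longrightarrow> p' \<in> C \<Longrightarrow> p \<le> p' \<or> p' \<le> p"
  shows "sublinear (\<lambda>x. INF p\<in>C. p x)" and "p \<in> C \<Longrightarrow> (INF p\<in>C. p x) \<le> p x"
proof -
  have low: "(INF p\<in>C. p x) \<le> p x" if "p \<in> C" for p x
  proof (rule cINF_lower[OF _ that])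
    show "bdd_below ((\<lambda>p. p x) ` C)"
    proof (rule bdd_belowI2)
      fix p assume "p \<in> C"
      then show "- q (- x) \<le> p x"
        using sublinear_minus[OF sub, of p x] le_funD[OF le, of p "- x"] by simp
    qed
  qed
  then show "p \<in> C \<Longrightarrow> (INF p\<in>C. p x) \<le> p x" .
  show "sublinear (\<lambda>x. INF p\<in>C. p x)"
    unfolding sublinear_def
  proof safe
    fix x y
    have "(INF p\<in>C. p (x + y)) - p' y \<le> (INF p\<in>C. p x)" if p': "p' \<in> C" for p'
    proof (rule cINF_greatest[OF ne])
      fix p assume p: "p \<in> C"
      from chain[OF p p'] show "(INF p\<in>C. p (x + y)) - p' y \<le> p x"
      proof
        assume "p \<le> p'"
        then show ?thesis
          using low[OF p, of "x + y"] sublinear_add[OF sub[OF p], of x y] le_funD[of p p' y] by simp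
      next
        assume "p' \<le> p"
        then show ?thesis
          using low[OF p', of "x + y"] sublinear_add[OF sub[OF p'], of x y] le_funD[of p' p x] by simp
      qed
    qed
    then have "(INF p\<in>C. p (x + y)) - (INF p\<in>C. p x) \<le> (INF p\<in>C. p y)"
      by (intro cINF_greatest[OF ne]) (simp add: algebra_simps)
    then show "(INF p\<in>C. p (x + y)) \<le> (INF p\<in>C. p x) + (INF p\<in>C. p y)" by simp
  next
    fix c :: real and x assume c: "0 \<le> c"
    have le: "(INF p\<in>C. p (c *\<^sub>R x)) \<le> c * p x" if "p \<in> C" for p
      using low[OF that, of "c *\<^sub>R x"] sublinear_scale[OF sub[OF that] c, of x] by simp
    show "(INF p\<in>C. p (c *\<^sub>R x)) \<le> c * (INF p\<in>C. p x)"
    proof (cases "c = 0")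
      case True
      then show ?thesis using le ne by auto
    next
      case False
      have "inverse c * (INF p\<in>C. p (c *\<^sub>R x)) \<le> (INF p\<in>C. p x)"
      proof (rule cINF_greatest[OF ne])
        fix p assume "p \<in> C"
        then show "inverse c * (INF p\<in>C. p (c *\<^sub>R x)) \<le> p x"
          using le[of p] False c by (simp add: field_simps)
      qed
      then show ?thesis using False c by (simp add: field_simps)
    qed
  qed
qed

lemma minimal_sublinear_exists:
  assumes q: "sublinear q"
  obtains p where "sublinear p" "p \<le> q" "\<And>p'. sublinear p' \<Longrightarrow> p' \<le> p \<Longrightarrow> p' = p"
proof -
  define A where "A = {p. sublinear p \<and> p \<le> q}"
  have "\<exists>m\<in>A. \<forall>a\<in>A. a \<le> m \<longrightarrow> a = m"
  proof (rule predicate_Zorn)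
    show "partial_order_on A (relation_of (\<lambda>p p'. p' \<le> p) A)"
      by (rule partial_order_on_relation_ofI) auto
    fix C assume "C \<in> Chains (relation_of (\<lambda>p p'. p' \<le> p) A)"
    then have CA: "\<And>p p'. p \<in> C \<Longrightarrow> p' \<in> C \<Longrightarrow> (p \<le> p' \<or> p' \<le> p) \<and> p \<in> A"
      by (auto simp: Chains_def relation_of_def)
    show "\<exists>u\<in>A. \<forall>a\<in>C. u \<le> a"
    proof (cases "C = {}")
      case True
      then show ?thesis using q by (auto simp: A_def)
    next
      case False
      then obtain p where p: "p \<in> C" by blast
      have sub: "\<And>p. p \<in> C \<Longrightarrow> sublinear p" and le: "\<And>p. p \<in> C \<Longrightarrow> p \<le> q"
        and ch: "\<And>p p'. p \<in> C \<Longrightarrow> p' \<in> C \<Longrightarrow> p \<le> p' \<or> p' \<le> p"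
        using CA by (auto simp: A_def)
      define u where "u = (\<lambda>x. INF p\<in>C. p x)"
      have u: "sublinear u" and low: "\<And>p. p \<in> C \<Longrightarrow> u \<le> p"
        unfolding u_def
        using sublinear_chain_INF[of C q, OF sub le False ch] by (auto simp: le_fun_def)
      moreover have "u \<le> q" using low[OF p] le[OF p] by simp
      ultimately show ?thesis by (auto simp: A_def)
    qed
  qed
  then show ?thesis
    using that by (auto simp: A_def intro: order_trans)
qed

text \<open>Hahn-Banach in the one instance needed: take a minimal sublinear \<open>p\<close> below the shift of the
  norm at \<open>x0\<close>. By minimality every shift of \<open>p\<close> equals \<open>p\<close>, which yields
  \<open>p x + p a \<le> p (x + a)\<close>, so \<open>p\<close> is linear.\<close>

lemma norming_functional_real:
  fixes x0 :: "'a::real_normed_vector"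
  obtains p :: "'a \<Rightarrow> real" where "linear p" "\<And>x. p x \<le> norm x" "p x0 = norm x0"
proof -
  have nrm: "sublinear (norm :: 'a \<Rightarrow> real)"
    by (simp add: sublinear_def norm_triangle_ineq)
  obtain p where p: "sublinear p" and pq: "p \<le> sublinear_shift norm x0"
    and min: "\<And>p'. sublinear p' \<Longrightarrow> p' \<le> p \<Longrightarrow> p' = p"
    using minimal_sublinear_exists[OF sublinear_sublinear_shift[OF nrm]] by blast
  have "sublinear_shift p a = p" for a
    by (rule min) (auto simp: le_fun_def sublinear_sublinear_shift[OF p] sublinear_shift_le_self[OF p])
  then have "p x \<le> p (x + a) - p a" for x a
    using sublinear_shift_le[OF p, of 1 a x] by simp
  then have add: "p (x + a) = p x + p a" for x a
    using sublinear_add[OF p, of x a] by (smt (verit))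
  have p0: "p 0 = 0" using add[of 0 0] by simp
  have neg: "p (- x) = - p x" for x using add[of x "- x"] p0 by simp
  have le: "p (c *\<^sub>R x) \<le> c * p x" if "0 \<le> c" for c x
    using sublinear_scale[OF p that] .
  have pos: "p (c *\<^sub>R x) = c * p x" if "0 \<le> c" for c x
    using le[OF that, of x] le[OF that, of "- x"] by (simp add: neg)
  have "linear p"
  proof (rule linearI)
    show "p (c *\<^sub>R x) = c *\<^sub>R p x" for c x
      using pos[of c x] pos[of "- c" x] neg[of "c *\<^sub>R x"] by (cases "0 \<le> c") auto
  qed (rule add)
  moreover have bound: "p x \<le> norm x" for x
    using le_funD[OF pq, of x] sublinear_shift_le_self[OF nrm, of x0 x] by simp
  moreover have "p (- x0) \<le> - norm x0"
    using le_funD[OF pq, of "- x0"] sublinear_shift_le[OF nrm, of 1 x0 "- x0"] by simp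
  then have "p x0 = norm x0" using neg[of x0] bound[of x0] by simp
  ultimately show ?thesis using that by blast
qed

text \<open>The real functional \<open>p\<close> is the real part of the complex-linear \<open>x \<mapsto> p x - \<i> p (\<i> x)\<close>; rotating
  \<open>x\<close> so that this value becomes real and nonnegative shows that its norm is still at most one.\<close>

lemma norming_functional_complex:
  fixes x0 :: "'a::complex_normed_vector"
  obtains l :: "'a \<Rightarrow> complex"
  where "bounded_linear l" "\<And>c x. l (c *\<^sub>C x) = c * l x" "\<And>x. cmod (l x) \<le> norm x"
    "Re (l x0) = norm x0"
proof -
  obtain p :: "'a \<Rightarrow> real" where lin: "linear p" and le: "\<And>x. p x \<le> norm x"
    and x0: "p x0 = norm x0"
    by (rule norming_functional_real[of x0]) blast
  define l where "l x = Complex (p x) (- p (\<i> *\<^sub>C x))" for x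
  have split: "c *\<^sub>C x = Re c *\<^sub>R x + Im c *\<^sub>R (\<i> *\<^sub>C x)" for c and x :: 'a
  proof -
    have "c *\<^sub>C x = (complex_of_real (Re c) + complex_of_real (Im c) * \<i>) *\<^sub>C x"
      by (simp add: complex_eq mult.commute flip: complex_eq)
    then show ?thesis
      by (simp add: scaleC_add_left scaleC_of_real flip: scaleC_scaleC)
  qed
  have minus: "(- 1) *\<^sub>C x = - x" for x :: 'a
    using scaleC_of_real[of "- 1" x] by simp
  have hom: "l (c *\<^sub>C x) = c * l x" for c x
  proof -
    have "p (c *\<^sub>C x) = Re c * p x + Im c * p (\<i> *\<^sub>C x)"
      by (subst split) (simp add: linear_add[OF lin] linear_scale[OF lin])
    moreover have "\<i> *\<^sub>C c *\<^sub>C x = Re c *\<^sub>R (\<i> *\<^sub>C x) - Im c *\<^sub>R x"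
      using split[of c "\<i> *\<^sub>C x"] by (simp add: scaleC_scaleC mult.commute minus)
    then have "p (\<i> *\<^sub>C c *\<^sub>C x) = Re c * p (\<i> *\<^sub>C x) - Im c * p x"
      by (simp add: linear_diff[OF lin] linear_scale[OF lin])
    ultimately show ?thesis by (simp add: l_def complex_eq_iff)
  qed
  have bound: "cmod (l x) \<le> norm x" for x
  proof (cases "l x = 0")
    case False
    define c where "c = cnj (l x) / cmod (l x)"
    have "cnj (l x) * l x = complex_of_real (cmod (l x)) * complex_of_real (cmod (l x))"
      using complex_norm_square[of "l x"] by (simp add: power2_eq_square mult.commute)
    then have "c * l x = cmod (l x)"
      using False by (simp add: c_def)
    then have "cmod (l x) = Re (l (c *\<^sub>C x))" by (simp add: hom)
    also have "\<dots> \<le> norm (c *\<^sub>C x)" by (simp add: l_def le)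
    also have "\<dots> = norm x" using False by (simp add: norm_scaleC c_def norm_divide)
    finally show ?thesis .
  qed simp
  have "bounded_linear l"
  proof (rule bounded_linear_intro[where K = 1])
    show "l (x + y) = l x + l y" for x y
      by (simp add: l_def complex_eq_iff scaleC_add_right linear_add[OF lin])
    show "l (r *\<^sub>R x) = r *\<^sub>R l x" for r x
      using hom[of "complex_of_real r" x] by (simp add: scaleC_of_real scaleR_conv_of_real)
  qed (simp add: bound)
  then show ?thesis using that[of l] hom bound x0 by (simp add: l_def)
qed

section \<open>Analytic functions and the Lipschitz norms\<close>

lemma disk_analytic_continuous_on: "disk_analytic f \<Longrightarrow> continuous_on (ball 0 1) f"
  unfolding disk_analytic_def
  by (meson continuous_at_imp_continuous_on has_derivative_continuous)

lemma disk_analytic_diff: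
  assumes "disk_analytic f" "disk_analytic g"
  shows "disk_analytic (\<lambda>z. f z - g z)"
  unfolding disk_analytic_def
proof
  fix z :: complex assume z: "z \<in> ball 0 1"
  obtain d e where "(f has_derivative (\<lambda>h. h *\<^sub>C d)) (at z)" "(g has_derivative (\<lambda>h. h *\<^sub>C e)) (at z)"
    using assms z unfolding disk_analytic_def by blast
  then have "((\<lambda>z. f z - g z) has_derivative (\<lambda>h. h *\<^sub>C d - h *\<^sub>C e)) (at z)"
    by (rule has_derivative_diff)
  moreover have "h *\<^sub>C d - h *\<^sub>C e = h *\<^sub>C (d - e)" for h
    by (simp add: linear_simps(2)[OF bounded_linear_scaleC_right])
  ultimately show "\<exists>d. ((\<lambda>z. f z - g z) has_derivative (\<lambda>h. h *\<^sub>C d)) (at z)"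
    by auto
qed

lemma disk_analytic_dilation:
  assumes an: "disk_analytic f" and r: "0 < r" "r \<le> 1"
  shows "disk_analytic (\<lambda>z. f (of_real r * z))"
  unfolding disk_analytic_def
proof
  fix z :: complex assume z: "z \<in> ball 0 1"
  then have "of_real r * z \<in> ball 0 1"
    using r by (simp add: norm_mult mult_less_le_imp_less) (smt (verit) mult_left_le_one_le norm_ge_zero)
  then obtain d where d: "(f has_derivative (\<lambda>h. h *\<^sub>C d)) (at (of_real r * z))"
    using an unfolding disk_analytic_def by blast
  have "((\<lambda>z. of_real r * z) has_derivative (\<lambda>h. of_real r * h)) (at z)"
    by (auto intro!: derivative_eq_intros)
  from has_derivative_compose[OF this d]
  have "((\<lambda>z. f (of_real r * z)) has_derivative (\<lambda>h. (of_real r * h) *\<^sub>C d)) (at z)" .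
  moreover have "(of_real r * h) *\<^sub>C d = h *\<^sub>C (of_real r *\<^sub>C d)" for h :: complex
    by (simp add: scaleC_scaleC mult.commute)
  ultimately show "\<exists>d. ((\<lambda>z. f (of_real r * z)) has_derivative (\<lambda>h. h *\<^sub>C d)) (at z)"
    by auto
qed

text \<open>In this form the diagonal \<open>z = w\<close> is included: both sides of the estimate vanish there.\<close>

lemma lip_space_iff:
  "f \<in> lip_space \<alpha> \<longleftrightarrow> disk_analytic f \<and>
     (\<exists>P. \<forall>z\<in>ball 0 1. \<forall>w\<in>ball 0 1. norm (f z - f w) \<le> P * cmod (z - w) powr \<alpha>)"
proof -
  have "bdd_above (lip_quot \<alpha> f ` off_diag) \<longleftrightarrow>
     (\<exists>P. \<forall>z\<in>ball 0 1. \<forall>w\<in>ball 0 1. norm (f z - f w) \<le> P * cmod (z - w) powr \<alpha>)"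
    (is "?L \<longleftrightarrow> ?R")
  proof
    assume ?L
    then obtain P where P: "\<And>z w. z \<in> ball 0 1 \<Longrightarrow> w \<in> ball 0 1 \<Longrightarrow> z \<noteq> w \<Longrightarrow>
        norm (f z - f w) / cmod (z - w) powr \<alpha> \<le> P"
      by (fastforce simp: bdd_above_def lip_quot_def off_diag_def)
    have "norm (f z - f w) \<le> P * cmod (z - w) powr \<alpha>" if "z \<in> ball 0 1" "w \<in> ball 0 1" for z w
      using P[OF that] by (cases "z = w") (auto simp: divide_le_eq)
    then show ?R by blast
  next
    assume ?R
    then show ?L
      by (fastforce simp: bdd_above_def lip_quot_def off_diag_def divide_le_eq)
  qed
  then show ?thesis by (simp add: lip_space_def)
qed

lemma lip_space_bounded:
  assumes "0 \<le> \<alpha>" and "f \<in> lip_space \<alpha>"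
  obtains M where "\<And>z. z \<in> ball 0 1 \<Longrightarrow> norm (f z) \<le> M"
proof -
  obtain P where P: "\<And>z w. z \<in> ball 0 1 \<Longrightarrow> w \<in> ball 0 1 \<Longrightarrow>
      norm (f z - f w) \<le> P * cmod (z - w) powr \<alpha>"
    using assms(2) unfolding lip_space_iff by blast
  have "norm (f z) \<le> norm (f 0) + \<bar>P\<bar>" if z: "z \<in> ball 0 1" for z
  proof -
    have "cmod (z - 0) powr \<alpha> \<le> 1" using z assms by (simp add: powr_le1)
    then have "\<bar>P\<bar> * cmod (z - 0) powr \<alpha> \<le> \<bar>P\<bar>" by (simp add: mult_left_le)
    moreover have "norm (f z - f 0) \<le> P * cmod (z - 0) powr \<alpha>"
      using P[OF z, of 0] by simp
    moreover have "P * cmod (z - 0) powr \<alpha> \<le> \<bar>P\<bar> * cmod (z - 0) powr \<alpha>"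
      by (intro mult_right_mono) auto
    ultimately show ?thesis using norm_triangle_sub[of "f z" "f 0"] by linarith
  qed
  then show ?thesis using that by blast
qed

lemma lip_norm_diff_bound:
  assumes a: "0 \<le> \<alpha>" and f: "f \<in> lip_space \<alpha>" and z: "z \<in> ball 0 1" and w: "w \<in> ball 0 1"
  shows "norm (f z - f w) \<le> lip_norm \<alpha> f * cmod (z - w) powr \<alpha>"
proof (cases "z = w")
  case False
  obtain M where M: "\<And>z. z \<in> ball 0 1 \<Longrightarrow> norm (f z) \<le> M"
    using lip_space_bounded[OF a f] by blast
  have "norm (f 0) \<le> (SUP z\<in>ball 0 1. norm (f z))"
    by (rule cSUP_upper) (auto intro!: bdd_aboveI2 M)
  then have "0 \<le> (SUP z\<in>ball 0 1. norm (f z))" by (rule order_trans[OF norm_ge_zero])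
  moreover have "lip_quot \<alpha> f (z, w) \<le> (SUP p\<in>off_diag. lip_quot \<alpha> f p)"
    using f z w False by (intro cSUP_upper) (auto simp: off_diag_def lip_space_def)
  ultimately have "lip_quot \<alpha> f (z, w) \<le> lip_norm \<alpha> f" by (simp add: lip_norm_def)
  then show ?thesis using False by (simp add: lip_quot_def divide_le_eq)
qed simp

lemma lip_norm_nonneg:
  assumes "0 \<le> \<alpha>" "f \<in> lip_space \<alpha>"
  shows "0 \<le> lip_norm \<alpha> f"
proof -
  have "norm (f (1 / 2) - f 0) \<le> lip_norm \<alpha> f * cmod (1 / 2 - 0) powr \<alpha>"
    by (rule lip_norm_diff_bound[OF assms]) (auto simp: norm_divide)
  then have "0 \<le> lip_norm \<alpha> f * cmod (1 / 2 - 0) powr \<alpha>"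
    using norm_ge_zero order_trans by blast
  then show ?thesis by (simp add: zero_le_mult_iff)
qed

lemma lip_norm_le:
  assumes A: "\<And>z. z \<in> ball 0 1 \<Longrightarrow> norm (f z) \<le> A"
    and B: "\<And>z w. z \<in> ball 0 1 \<Longrightarrow> w \<in> ball 0 1 \<Longrightarrow> norm (f z - f w) \<le> B * cmod (z - w) powr \<alpha>"
  shows "lip_norm \<alpha> f \<le> A + B"
  unfolding lip_norm_def
proof (rule add_mono)
  show "(SUP z\<in>ball 0 1. norm (f z)) \<le> A"
    by (rule cSUP_least) (use A in auto)
  have "(0, 1 / 2) \<in> off_diag" by (simp add: off_diag_def norm_divide)
  then have "off_diag \<noteq> {}" by blast
  then show "(SUP p\<in>off_diag. lip_quot \<alpha> f p) \<le> B"
    by (rule cSUP_least) (use B in \<open>auto simp: off_diag_def lip_quot_def divide_le_eq\<close>)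
qed

lemma little_lip_space_iff:
  "f \<in> little_lip_space \<alpha> \<longleftrightarrow> f \<in> lip_space \<alpha> \<and>
     (\<forall>e>0. \<exists>d>0. \<forall>z\<in>ball 0 1. \<forall>w\<in>ball 0 1.
        cmod (z - w) < d \<longrightarrow> norm (f z - f w) \<le> e * cmod (z - w) powr \<alpha>)"
proof -
  define F where "F = inf (filtercomap (\<lambda>(z, w). cmod (z - w)) (at_right 0)) (principal off_diag)"
  have ev: "eventually Q F \<longleftrightarrow> (\<exists>d>0. \<forall>z\<in>ball 0 1. \<forall>w\<in>ball 0 1. z \<noteq> w \<longrightarrow>
      cmod (z - w) < d \<longrightarrow> Q (z, w))" for Q
  proof
    assume "eventually Q F"
    then obtain R where R: "eventually R (at_right 0)"
      and Q: "\<And>z w. R (cmod (z - w)) \<Longrightarrow> (z, w) \<in> off_diag \<Longrightarrow> Q (z, w)"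
      unfolding F_def eventually_inf_principal eventually_filtercomap by fastforce
    from R obtain d where "0 < d" "\<And>t. 0 < t \<Longrightarrow> t < d \<Longrightarrow> R t"
      unfolding eventually_at_right_field by blast
    then show "\<exists>d>0. \<forall>z\<in>ball 0 1. \<forall>w\<in>ball 0 1. z \<noteq> w \<longrightarrow> cmod (z - w) < d \<longrightarrow> Q (z, w)"
      using Q by (intro exI[of _ d]) (simp add: off_diag_def)
  next
    assume "\<exists>d>0. \<forall>z\<in>ball 0 1. \<forall>w\<in>ball 0 1. z \<noteq> w \<longrightarrow> cmod (z - w) < d \<longrightarrow> Q (z, w)"
    then obtain d where d: "0 < d" "\<And>z w. (z, w) \<in> off_diag \<Longrightarrow> cmod (z - w) < d \<Longrightarrow> Q (z, w)"
      unfolding off_diag_def by blast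
    have "eventually (\<lambda>t. t < d) (at_right 0)"
      using d(1) unfolding eventually_at_right_field by blast
    moreover have "(case p of (z, w) \<Rightarrow> cmod (z - w)) < d \<longrightarrow> p \<in> off_diag \<longrightarrow> Q p" for p
      using d(2) by (cases p) simp
    ultimately show "eventually Q F"
      unfolding F_def eventually_inf_principal eventually_filtercomap by blast
  qed
  have "(lip_quot \<alpha> f \<longlongrightarrow> 0) F \<longleftrightarrow>
      (\<forall>e>0. \<exists>d>0. \<forall>z\<in>ball 0 1. \<forall>w\<in>ball 0 1. z \<noteq> w \<longrightarrow> cmod (z - w) < d \<longrightarrow>
        norm (f z - f w) < e * cmod (z - w) powr \<alpha>)"
    by (simp add: tendsto_iff ev lip_quot_def divide_less_eq)
  also have "\<dots> \<longleftrightarrow> (\<forall>e>0. \<exists>d>0. \<forall>z\<in>ball 0 1. \<forall>w\<in>ball 0 1.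
        cmod (z - w) < d \<longrightarrow> norm (f z - f w) \<le> e * cmod (z - w) powr \<alpha>)" (is "?L \<longleftrightarrow> ?R")
  proof
    assume ?L
    show ?R
    proof (intro allI impI)
      fix e :: real assume e: "0 < e"
      obtain d where d: "0 < d" "\<And>z w. z \<in> ball 0 1 \<Longrightarrow> w \<in> ball 0 1 \<Longrightarrow> z \<noteq> w \<Longrightarrow>
          cmod (z - w) < d \<Longrightarrow> norm (f z - f w) < e * cmod (z - w) powr \<alpha>"
        using \<open>?L\<close>[rule_format, OF e] by blast
      have "norm (f z - f w) \<le> e * cmod (z - w) powr \<alpha>"
        if "z \<in> ball 0 1" "w \<in> ball 0 1" "cmod (z - w) < d" for z w
        using d(2)[OF that(1,2) _ that(3)] by (cases "z = w") auto
      then show "\<exists>d>0. \<forall>z\<in>ball 0 1. \<forall>w\<in>ball 0 1.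
          cmod (z - w) < d \<longrightarrow> norm (f z - f w) \<le> e * cmod (z - w) powr \<alpha>"
        using d(1) by blast
    qed
  next
    assume R: ?R
    show ?L
    proof (intro allI impI)
      fix e :: real assume e: "0 < e"
      obtain d where d: "0 < d" "\<And>z w. z \<in> ball 0 1 \<Longrightarrow> w \<in> ball 0 1 \<Longrightarrow> cmod (z - w) < d \<Longrightarrow>
          norm (f z - f w) \<le> e / 2 * cmod (z - w) powr \<alpha>"
        using R[rule_format, OF half_gt_zero[OF e]] by blast
      have "norm (f z - f w) < e * cmod (z - w) powr \<alpha>"
        if "z \<in> ball 0 1" "w \<in> ball 0 1" "z \<noteq> w" "cmod (z - w) < d" for z w
      proof -
        have "0 < cmod (z - w) powr \<alpha>" using that by simp
        then have "e / 2 * cmod (z - w) powr \<alpha> < e * cmod (z - w) powr \<alpha>"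
          using e by (intro mult_strict_right_mono) auto
        then show ?thesis using d(2)[of z w] that by linarith
      qed
      then show "\<exists>d>0. \<forall>z\<in>ball 0 1. \<forall>w\<in>ball 0 1. z \<noteq> w \<longrightarrow> cmod (z - w) < d \<longrightarrow>
          norm (f z - f w) < e * cmod (z - w) powr \<alpha>"
        using d(1) by blast
    qed
  qed
  finally show ?thesis by (simp add: little_lip_space_def F_def)
qed

section \<open>Dilations\<close>

text \<open>For scalar functions this is the Cauchy estimate for the derivative on \<open>cball 0 r\<close>. Its
  constant depends only on the bound \<open>M\<close> and on \<open>r\<close>, so it holds uniformly for \<open>l \<circ> f\<close> over all
  functionals \<open>l\<close> of norm at most one; choosing \<open>l\<close> norming for the increment in question gives the
  vector-valued claim.\<close>

lemma disk_analytic_dilation_lipschitz: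
  fixes f :: "complex \<Rightarrow> 'a::complex_normed_vector"
  assumes an: "disk_analytic f" and M: "\<And>z. z \<in> ball 0 1 \<Longrightarrow> norm (f z) \<le> M"
    and r: "0 < r" "r < 1"
  shows "\<exists>L\<ge>0. \<forall>u\<in>ball 0 1. \<forall>v\<in>ball 0 1.
      norm (f (of_real r * u) - f (of_real r * v)) \<le> L * cmod (u - v)"
proof -
  define s where "s = (1 - r) / 2"
  have s: "0 < s" "r + s < 1" using r by (auto simp: s_def field_simps)
  have M0: "0 \<le> M" using M[of 0] norm_ge_zero[of "f 0"] by (simp del: norm_ge_zero)
  have "norm (f (of_real r * u) - f (of_real r * v)) \<le> M / s * cmod (u - v)"
    if u: "u \<in> ball 0 1" and v: "v \<in> ball 0 1" for u v
  proof -
    obtain l :: "'a \<Rightarrow> complex" where lb: "bounded_linear l" and hom: "\<And>c x. l (c *\<^sub>C x) = c * l x"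
      and le: "\<And>x. cmod (l x) \<le> norm x"
      and l0: "Re (l (f (of_real r * u) - f (of_real r * v))) = norm (f (of_real r * u) - f (of_real r * v))"
      by (rule norming_functional_complex[of "f (of_real r * u) - f (of_real r * v)"]) blast
    define g where "g z = l (f z)" for z
    have gb: "cmod (g z) \<le> M" if "z \<in> ball 0 1" for z
      using le[of "f z"] M[OF that] by (simp add: g_def)
    have hol: "g holomorphic_on ball 0 1"
    proof (rule holomorphic_onI)
      fix z :: complex assume "z \<in> ball 0 1"
      with an obtain d where "(f has_derivative (\<lambda>h. h *\<^sub>C d)) (at z)"
        unfolding disk_analytic_def by blast
      then have "((\<lambda>z. l (f z)) has_derivative (\<lambda>h. l (h *\<^sub>C d))) (at z)"
        by (rule bounded_linear.has_derivative[OF lb])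
      moreover have "(\<lambda>h. l (h *\<^sub>C d)) = (*) (l d)"
        by (auto simp: hom mult.commute)
      ultimately have "(g has_field_derivative l d) (at z)"
        by (simp add: has_field_derivative_def g_def[abs_def])
      then show "g field_differentiable at z within ball 0 1"
        using field_differentiable_def field_differentiable_at_within by blast
    qed
    have "cmod (deriv g z) \<le> M / s" if z: "z \<in> cball 0 r" for z
    proof -
      have sub: "cball z s \<subseteq> ball 0 1"
        using z s by (auto simp: subset_iff dist_norm norm_minus_commute)
          (smt (verit) norm_triangle_sub norm_minus_commute)
      have "cmod ((deriv ^^ 1) g z) \<le> fact 1 * M / s ^ 1"
      proof (rule Cauchy_inequality)
        show "g holomorphic_on ball z s"
          using hol sub by (meson ball_subset_cball holomorphic_on_subset subset_trans)
        show "continuous_on (cball z s) g"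
          using hol sub by (meson holomorphic_on_imp_continuous_on continuous_on_subset)
        show "cmod (g w) \<le> M" if "cmod (z - w) = s" for w
          using that sub by (intro gb) (auto simp: subset_iff dist_norm)
      qed (use s in auto)
      then show ?thesis by simp
    qed
    moreover have "(g has_field_derivative deriv g z) (at z within cball 0 r)" if "z \<in> cball 0 r" for z
      using that r hol by (intro DERIV_subset[OF holomorphic_derivI[of g "ball 0 1"]]) auto
    ultimately have "cmod (g (of_real r * u) - g (of_real r * v)) \<le> M / s * cmod (of_real r * u - of_real r * v)"
      using u v r
      by (intro field_differentiable_bound[of "cball 0 r" g "deriv g"])
        (auto simp: norm_mult intro!: mult_left_le)
    also have "\<dots> = M / s * (r * cmod (u - v))"
      using r by (simp add: norm_mult flip: right_diff_distrib)
    also have "\<dots> \<le> M / s * cmod (u - v)"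
      using r s M0 by (intro mult_left_mono) (auto intro: mult_left_le_one_le)
    finally have "cmod (g (of_real r * u) - g (of_real r * v)) \<le> M / s * cmod (u - v)" .
    moreover have "g (of_real r * u) - g (of_real r * v) = l (f (of_real r * u) - f (of_real r * v))"
      by (simp add: g_def bounded_linear.linear[OF lb] linear_diff)
    ultimately show ?thesis
      using l0 complex_Re_le_cmod order_trans by metis
  qed
  moreover have "0 \<le> M / s" using M0 s by simp
  ultimately show ?thesis by blast
qed

text \<open>Write \<open>h z = f z - f (r z)\<close>. For close points the increments of \<open>f\<close> and of its dilation are
  separately small, uniformly in \<open>r\<close>, since dilation only brings points closer. For points at
  distance at least \<open>d\<close> the increment of \<open>h\<close> is at most twice its supremum, which the
  Hoelder estimate bounds by a multiple of \<open>(1 - r)\<^sup>\<alpha>\<close>.\<close>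

lemma little_lip_dilation_approx:
  assumes a: "0 < \<alpha>" and f: "f \<in> little_lip_space \<alpha>" and e: "0 < e"
  obtains r where "0 < r" "r < 1"
    "(\<lambda>z. f z - f (of_real r * z)) \<in> lip_space \<alpha>"
    "lip_norm \<alpha> (\<lambda>z. f z - f (of_real r * z)) \<le> e"
proof -
  have fl: "f \<in> lip_space \<alpha>" and an: "disk_analytic f"
    using f by (auto simp: little_lip_space_def lip_space_def)
  then obtain P0 where "\<forall>z\<in>ball 0 1. \<forall>w\<in>ball 0 1. norm (f z - f w) \<le> P0 * cmod (z - w) powr \<alpha>"
    by (auto simp: lip_space_iff)
  define P where "P = \<bar>P0\<bar> + 1"
  have P0: "0 < P" by (simp add: P_def)
  have P: "norm (f z - f w) \<le> P * cmod (z - w) powr \<alpha>" if "z \<in> ball 0 1" "w \<in> ball 0 1" for z w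
  proof -
    have "P0 * cmod (z - w) powr \<alpha> \<le> P * cmod (z - w) powr \<alpha>"
      by (intro mult_right_mono) (auto simp: P_def)
    then show ?thesis
      using \<open>\<forall>z\<in>ball 0 1. \<forall>w\<in>ball 0 1. norm (f z - f w) \<le> P0 * cmod (z - w) powr \<alpha>\<close> that
      by fastforce
  qed
  define b where "b = e / 4"
  have b: "0 < b" using e by (simp add: b_def)
  obtain d where d: "0 < d" and small: "\<And>z w. z \<in> ball 0 1 \<Longrightarrow> w \<in> ball 0 1 \<Longrightarrow> cmod (z - w) < d \<Longrightarrow>
      norm (f z - f w) \<le> b * cmod (z - w) powr \<alpha>"
    using f b unfolding little_lip_space_iff by metis
  define c where "c = b * min 1 (d powr \<alpha>)"
  have c: "0 < c" "c \<le> b" "c \<le> b * d powr \<alpha>"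
    using b d by (auto simp: c_def mult_left_le intro!: mult_left_mono)
  have "((\<lambda>r. P * (1 - r) powr \<alpha>) \<longlongrightarrow> P * (1 - 1) powr \<alpha>) (at_left (1::real))"
    using a by (intro tendsto_intros) (auto simp: eventually_at_left_field intro!: exI[of _ 0])
  then have "\<forall>\<^sub>F r in at_left (1::real). P * (1 - r) powr \<alpha> < c"
    using c by (intro order_tendstoD(2)) auto
  moreover have "\<forall>\<^sub>F r in at_left (1::real). 0 < r \<and> r < 1"
    by (auto simp: eventually_at_left_field intro!: exI[of _ 0])
  ultimately have "\<forall>\<^sub>F r in at_left (1::real). 0 < r \<and> r < 1 \<and> P * (1 - r) powr \<alpha> < c"
    by eventually_elim auto
  then obtain r where r: "0 < r" "r < 1" and rc: "P * (1 - r) powr \<alpha> < c"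
    using eventually_happens[of _ "at_left (1::real)"] by (auto simp: trivial_limit_at_left_real)
  define g where "g z = f (of_real r * z)" for z
  have in_ball: "of_real r * z \<in> ball 0 1" if "z \<in> ball 0 1" for z :: complex
    using that r by (simp add: norm_mult) (smt (verit) mult_left_le_one_le norm_ge_zero)
  have rd: "cmod (of_real r * z - of_real r * w) = r * cmod (z - w)" for z w
    using r by (simp add: norm_mult flip: right_diff_distrib)
  have rd_le: "r * cmod (z - w) \<le> cmod (z - w)" for z w
    using r by (simp add: mult_left_le_one_le)
  have rp: "(r * cmod (z - w)) powr \<alpha> \<le> cmod (z - w) powr \<alpha>" for z w
    using r a rd_le by (intro powr_mono2) auto
  have g_diff: "norm (g z - g w) \<le> P * cmod (z - w) powr \<alpha>" if "z \<in> ball 0 1" "w \<in> ball 0 1" for z w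
  proof -
    have "norm (g z - g w) \<le> P * (r * cmod (z - w)) powr \<alpha>"
      using P[OF in_ball[OF that(1)] in_ball[OF that(2)]] by (simp add: g_def rd)
    also have "\<dots> \<le> P * cmod (z - w) powr \<alpha>"
      using P0 by (intro mult_left_mono rp) simp
    finally show ?thesis .
  qed
  have g_small: "norm (g z - g w) \<le> b * cmod (z - w) powr \<alpha>"
    if "z \<in> ball 0 1" "w \<in> ball 0 1" "cmod (z - w) < d" for z w
  proof -
    have "norm (g z - g w) \<le> b * (r * cmod (z - w)) powr \<alpha>"
      using small[OF in_ball[OF that(1)] in_ball[OF that(2)]] rd_le[of z w] that(3)
      by (simp add: g_def rd)
    also have "\<dots> \<le> b * cmod (z - w) powr \<alpha>"
      using b by (intro mult_left_mono rp) simp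
    finally show ?thesis .
  qed
  have gl: "g \<in> lip_space \<alpha>"
  proof -
    have "disk_analytic g"
      using disk_analytic_dilation[OF an, of r] r by (simp add: g_def[abs_def])
    then show ?thesis unfolding lip_space_iff using g_diff by blast
  qed
  have sup: "norm (f z - g z) \<le> c" if z: "z \<in> ball 0 1" for z
  proof -
    have "z - of_real r * z = of_real (1 - r) * z" by (simp add: algebra_simps)
    then have "cmod (z - of_real r * z) = (1 - r) * cmod z"
      using r by (simp only: norm_mult norm_of_real)
    also have "\<dots> \<le> 1 - r" using z r by (simp add: mult_left_le)
    finally have "P * cmod (z - of_real r * z) powr \<alpha> \<le> P * (1 - r) powr \<alpha>"
      using P0 a by (intro mult_left_mono powr_mono2) auto
    then show ?thesis using P[OF z in_ball[OF z]] rc by (simp add: g_def)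
  qed
  have diff: "norm ((f z - g z) - (f w - g w)) \<le> 2 * b * cmod (z - w) powr \<alpha>"
    if z: "z \<in> ball 0 1" and w: "w \<in> ball 0 1" for z w
  proof (cases "cmod (z - w) < d")
    case True
    have "norm ((f z - g z) - (f w - g w)) \<le> norm (f z - f w) + norm (g z - g w)"
      using norm_triangle_ineq4[of "f z - f w" "g z - g w"] by (simp add: algebra_simps)
    then show ?thesis using small[OF z w True] g_small[OF z w True] by simp
  next
    case False
    then have "b * d powr \<alpha> \<le> b * cmod (z - w) powr \<alpha>"
      using b d a by (intro mult_left_mono powr_mono2) auto
    moreover have "norm ((f z - g z) - (f w - g w)) \<le> c + c"
      using norm_triangle_ineq4[of "f z - g z" "f w - g w"] sup[OF z] sup[OF w] by linarith
    ultimately show ?thesis using c by linarith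
  qed
  have "(\<lambda>z. f z - g z) \<in> lip_space \<alpha>"
  proof -
    have "disk_analytic (\<lambda>z. f z - g z)"
      using disk_analytic_diff[OF an, of g] gl by (simp add: lip_space_def)
    then show ?thesis unfolding lip_space_iff using diff by blast
  qed
  moreover have "lip_norm \<alpha> (\<lambda>z. f z - g z) \<le> e"
    using lip_norm_le[of "\<lambda>z. f z - g z" c "2 * b" \<alpha>] sup diff c b by (simp add: b_def)
  ultimately show ?thesis
    using that[OF r] by (simp add: g_def[abs_def])
qed

section \<open>A local Hardy-Littlewood theorem\<close>

text \<open>Integrate \<open>\<phi>'\<close> along the curve \<open>\<gamma> t = (1 - d t (1 - t)) (w + t (z - w))\<close> with \<open>d = \<bar>z - w\<bar>\<close>, the
  chord pushed towards the origin. Its speed is at most \<open>2 d\<close>, and \<open>1 - \<bar>\<gamma> t\<bar> \<ge> d t (1 - t)\<close>, so the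
  singular weight is integrable in \<open>t\<close> and contributes \<open>d powr (\<beta> - 1)\<close>. The hypothesis on \<open>\<phi>'\<close> is
  local because \<open>\<gamma>\<close> stays within distance \<open>2 d\<close> of \<open>w\<close>; this is what the dichotomy for the
  multiplier relies on.\<close>

lemma Hardy_Littlewood_local:
  assumes hol: "\<phi> holomorphic_on ball 0 1" and b: "0 < \<beta>" "\<beta> \<le> 1" and M: "0 \<le> M"
    and z: "z \<in> ball 0 1" and w: "w \<in> ball 0 1"
    and bound: "\<And>\<zeta>. \<zeta> \<in> ball 0 1 \<Longrightarrow> cmod (\<zeta> - w) \<le> 2 * cmod (z - w) \<Longrightarrow>
      cmod (deriv \<phi> \<zeta>) \<le> M * (1 - cmod \<zeta>) powr (\<beta> - 1) + K"
  shows "cmod (\<phi> z - \<phi> w) \<le> 8 * M / \<beta> * cmod (z - w) powr \<beta> + 2 * K * cmod (z - w)"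
proof (cases "z = w")
  case False
  define d where "d = cmod (z - w)"
  have d: "0 < d" using False by (simp add: d_def)
  have d2: "d \<le> 2" using norm_triangle_ineq4[of z w] z w by (simp add: d_def)
  define s where "s t = 1 - d * (t * (1 - t))" for t :: real
  define u where "u t = w + of_real t * (z - w)" for t :: real
  define \<gamma> where "\<gamma> t = of_real (s t) * u t" for t :: real
  define \<gamma>' where "\<gamma>' t = of_real (s t) * (z - w) + of_real (- (d * (1 - 2 * t))) * u t" for t :: real
  \<comment> \<open>A primitive of the majorant that arises from
      \<open>(t (1 - t)) powr (\<beta> - 1) \<le> 2 (t powr (\<beta> - 1) + (1 - t) powr (\<beta> - 1))\<close>.\<close>
  define \<Phi> where "\<Phi> t = 4 * M * d powr \<beta> * ((t powr \<beta> - (1 - t) powr \<beta>) / \<beta>) + 2 * K * d * t"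
    for t :: real
  define \<Phi>' where "\<Phi>' t = 4 * M * d powr \<beta> * (t powr (\<beta> - 1) + (1 - t) powr (\<beta> - 1)) + 2 * K * d"
    for t :: real
  have tt: "0 \<le> t * (1 - t)" "d * (t * (1 - t)) \<le> 1 / 2" if "0 \<le> t" "t \<le> 1" for t :: real
  proof -
    show p: "0 \<le> t * (1 - t)" using that by simp
    have "0 \<le> (t - 1 / 2)\<^sup>2" by simp
    then have "t * (1 - t) \<le> 1 / 4" by (simp add: power2_eq_square algebra_simps)
    then have "d * (t * (1 - t)) \<le> 2 * (1 / 4)" using d d2 p by (intro mult_mono) auto
    then show "d * (t * (1 - t)) \<le> 1 / 2" by simp
  qed
  have s: "0 \<le> s t" "s t \<le> 1" if "0 \<le> t" "t \<le> 1" for t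
    using tt[OF that] d by (auto simp: s_def)
  have u: "cmod (u t) < 1" if "0 \<le> t" "t \<le> 1" for t
  proof -
    have "(1 - t) *\<^sub>R w + t *\<^sub>R z \<in> ball 0 1"
      using convexD_alt[OF convex_ball w z that] .
    moreover have "(1 - t) *\<^sub>R w + t *\<^sub>R z = u t"
      by (simp add: u_def scaleR_conv_of_real algebra_simps)
    ultimately show ?thesis by simp
  qed
  have gs: "cmod (\<gamma> t) \<le> s t" if "0 \<le> t" "t \<le> 1" for t
    using s[OF that] u[OF that] by (simp add: \<gamma>_def norm_mult mult_left_le)
  have g_ball: "\<gamma> t \<in> ball 0 1" if "0 \<le> t" "t \<le> 1" for t
  proof -
    have "cmod (\<gamma> t) \<le> cmod (u t)"
      using s[OF that] by (simp add: \<gamma>_def norm_mult mult_left_le_one_le)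
    then show ?thesis using u[OF that] by simp
  qed
  have g_near: "cmod (\<gamma> t - w) \<le> 2 * cmod (z - w)" if t: "0 \<le> t" "t \<le> 1" for t
  proof -
    have "\<gamma> t - w = of_real t * (z - w) - of_real (d * (t * (1 - t))) * u t"
      by (simp add: \<gamma>_def s_def u_def algebra_simps)
    then have "cmod (\<gamma> t - w) \<le> cmod (of_real t * (z - w)) + cmod (of_real (d * (t * (1 - t))) * u t)"
      using norm_triangle_ineq4 by metis
    also have "cmod (of_real t * (z - w)) \<le> d"
      using t by (simp add: norm_mult d_def mult_left_le_one_le)
    also have "cmod (of_real (d * (t * (1 - t))) * u t) \<le> d * 1 * 1"
    proof -
      have "t * (1 - t) \<le> 1" using t by (simp add: mult_le_one)
      then show ?thesis
        unfolding norm_mult[of "of_real _" "u t"] norm_of_real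
        using u[OF t] tt(1)[OF t] d by (intro mult_mono) (auto simp: abs_mult)
    qed
    finally show ?thesis by (simp add: d_def)
  qed
  have "cmod ((\<phi> \<circ> \<gamma>) 1 - (\<phi> \<circ> \<gamma>) 0) \<le> \<Phi> 1 - \<Phi> 0"
  proof (rule differentiable_bound_general[where f' = "\<lambda>t. \<gamma>' t * deriv \<phi> (\<gamma> t)" and \<phi>' = \<Phi>'])
    show "continuous_on {0..1} (\<phi> \<circ> \<gamma>)"
    proof (rule continuous_on_compose)
      show "continuous_on {0..1} \<gamma>"
        unfolding \<gamma>_def[abs_def] s_def u_def by (intro continuous_intros)
      show "continuous_on (\<gamma> ` {0..1}) \<phi>"
        using holomorphic_on_imp_continuous_on[OF hol] g_ball
        by (elim continuous_on_subset) auto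
    qed
    show "continuous_on {0..1} \<Phi>"
      unfolding \<Phi>_def[abs_def] using b by (intro continuous_intros continuous_on_powr') auto
    fix t :: real assume t: "0 < t" "t < 1"
    have "(\<gamma> has_vector_derivative \<gamma>' t) (at t)"
      unfolding \<gamma>_def[abs_def] \<gamma>'_def s_def u_def has_vector_derivative_def
      by (auto intro!: derivative_eq_intros simp: fun_eq_iff scaleR_conv_of_real algebra_simps)
    moreover have "(\<phi> has_field_derivative deriv \<phi> (\<gamma> t)) (at (\<gamma> t))"
      using holomorphic_derivI[OF hol open_ball g_ball[of t]] t by simp
    ultimately show "((\<phi> \<circ> \<gamma>) has_vector_derivative \<gamma>' t * deriv \<phi> (\<gamma> t)) (at t)"
      by (rule field_vector_diff_chain_at)
    have "(\<Phi> has_field_derivative \<Phi>' t) (at t)"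
      unfolding \<Phi>_def[abs_def] \<Phi>'_def using t b
      by (auto intro!: derivative_eq_intros simp: field_simps)
    then show "(\<Phi> has_vector_derivative \<Phi>' t) (at t)"
      by (simp add: has_real_derivative_iff_has_vector_derivative)
    define T where "T = t powr (\<beta> - 1) + (1 - t) powr (\<beta> - 1)"
    \<comment> \<open>One of \<open>t\<close> and \<open>1 - t\<close> is at least \<open>1 / 2\<close>, and \<open>(1 / 2) powr (\<beta> - 1) \<le> 2\<close>.\<close>
    have T: "(t * (1 - t)) powr (\<beta> - 1) \<le> 2 * T"
    proof -
      have half: "(x * y) powr (\<beta> - 1) \<le> 2 * x powr (\<beta> - 1)" if "0 < x" "1 / 2 \<le> y" for x y :: real
      proof -
        have "y powr (\<beta> - 1) \<le> (1 / 2) powr (\<beta> - 1)"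
          using that b by (intro powr_mono2') auto
        also have "\<dots> = 2 powr (1 - \<beta>)"
          by (simp add: powr_divide powr_diff)
        also have "\<dots> \<le> 2 powr 1" using b by (intro powr_mono) auto
        finally have "x powr (\<beta> - 1) * y powr (\<beta> - 1) \<le> x powr (\<beta> - 1) * 2"
          by (intro mult_left_mono) auto
        then show ?thesis using that by (simp add: powr_mult mult.commute)
      qed
      have "0 \<le> t powr (\<beta> - 1)" "0 \<le> (1 - t) powr (\<beta> - 1)" by simp_all
      moreover have "(t * (1 - t)) powr (\<beta> - 1) \<le> 2 * t powr (\<beta> - 1) \<or>
          (t * (1 - t)) powr (\<beta> - 1) \<le> 2 * (1 - t) powr (\<beta> - 1)"
        using half[of t "1 - t"] half[of "1 - t" t] t
        by (cases "t \<le> 1 / 2") (auto simp: mult.commute)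
      ultimately show ?thesis unfolding T_def distrib_left by linarith
    qed
    have "cmod (\<gamma>' t) \<le> cmod (of_real (s t) * (z - w)) + cmod (of_real (- (d * (1 - 2 * t))) * u t)"
      unfolding \<gamma>'_def by (rule norm_triangle_ineq)
    also have "cmod (of_real (s t) * (z - w)) \<le> d"
      using s[of t] t d by (simp add: norm_mult d_def mult_left_le_one_le)
    also have "cmod (of_real (- (d * (1 - 2 * t))) * u t) \<le> d * 1 * 1"
      unfolding norm_mult[of "of_real _" "u t"] norm_of_real
      using u[of t] t d by (intro mult_mono) (auto simp: abs_mult)
    finally have g': "cmod (\<gamma>' t) \<le> 2 * d" by simp
    have "(1 - cmod (\<gamma> t)) powr (\<beta> - 1) \<le> (d * (t * (1 - t))) powr (\<beta> - 1)"
      using gs[of t] t d b by (intro powr_mono2') (auto simp: s_def)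
    also have "\<dots> = d powr (\<beta> - 1) * (t * (1 - t)) powr (\<beta> - 1)"
      using d t by (simp add: powr_mult)
    also have "\<dots> \<le> d powr (\<beta> - 1) * (2 * T)" using T by (intro mult_left_mono) auto
    finally have "M * (1 - cmod (\<gamma> t)) powr (\<beta> - 1) \<le> M * (d powr (\<beta> - 1) * (2 * T))"
      using M by (intro mult_left_mono)
    then have "cmod (deriv \<phi> (\<gamma> t)) \<le> M * (d powr (\<beta> - 1) * (2 * T)) + K"
      using bound[OF g_ball g_near, of t] t by simp
    then have "cmod (\<gamma>' t * deriv \<phi> (\<gamma> t)) \<le> (2 * d) * (M * (d powr (\<beta> - 1) * (2 * T)) + K)"
      unfolding norm_mult using g' d by (intro mult_mono) auto
    also have "\<dots> = 4 * M * (d powr (\<beta> - 1) * d) * T + 2 * K * d"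
      by (simp add: algebra_simps)
    also have "d powr (\<beta> - 1) * d = d powr \<beta>"
      using d by (simp add: powr_diff)
    finally show "cmod (\<gamma>' t * deriv \<phi> (\<gamma> t)) \<le> \<Phi>' t" by (simp add: \<Phi>'_def T_def)
  qed simp
  moreover have "\<gamma> 1 = z" "\<gamma> 0 = w" by (simp_all add: \<gamma>_def s_def u_def)
  moreover have "\<Phi> 1 - \<Phi> 0 = 8 * M / \<beta> * d powr \<beta> + 2 * K * d"
    using b by (simp add: \<Phi>_def field_simps)
  ultimately show ?thesis by (simp add: d_def)
qed simp

section \<open>The multiplier against increments of the symbol\<close>

text \<open>The little Lipschitz condition with exponent one says that the derivative vanishes.\<close>

lemma little_lip_one_constant:
  assumes "f \<in> little_lip_space 1"
  obtains c where "\<And>z. z \<in> ball 0 1 \<Longrightarrow> f z = c"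
proof -
  have "\<exists>c. \<forall>z\<in>ball 0 1. f z = c"
  proof (rule has_derivative_zero_constant)
    fix z :: complex assume z: "z \<in> ball 0 1"
    show "(f has_derivative (\<lambda>h. 0)) (at z within ball 0 1)"
      unfolding has_derivative_within_alt
    proof (intro conjI allI impI)
      fix e :: real assume "0 < e"
      then obtain d where "0 < d" "\<And>y. y \<in> ball 0 1 \<Longrightarrow> cmod (y - z) < d \<Longrightarrow>
          norm (f y - f z) \<le> e * cmod (y - z) powr 1"
        using assms z unfolding little_lip_space_iff by metis
      then show "\<exists>d>0. \<forall>y\<in>ball 0 1. norm (y - z) < d \<longrightarrow> norm (f y - f z - 0) \<le> e * norm (y - z)"
        by (intro exI[of _ d]) auto
    qed simp
  qed simp
  then show ?thesis using that by blast
qed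

text \<open>The boundary limit controls \<open>\<phi>' \<psi>\<close> near the circle, and compactness bounds it by some \<open>K\<close> inside.
  The constant \<open>K\<close> will contribute a multiple of \<open>K d\<close>, which is \<open>o(d\<^sup>\<beta>)\<close> for \<open>\<beta> < 1\<close>. For \<open>\<beta> = 1\<close> the
  multiplier is constant, so the boundary smallness of \<open>\<phi>'\<close> spreads to the whole disk by the maximum
  principle and \<open>K = 0\<close> is possible.\<close>

lemma boundary_limit_global_bound:
  fixes \<psi> :: "complex \<Rightarrow> 'a::complex_normed_vector"
  assumes hol: "\<phi> holomorphic_on ball 0 1" and psi: "\<psi> \<in> little_lip_space \<beta>" and b: "\<beta> \<le> 1"
    and lim: "((\<lambda>z. (1 - (cmod z)\<^sup>2) powr (1 - \<beta>) *\<^sub>R (deriv \<phi> z *\<^sub>C \<psi> z)) \<longlongrightarrow> 0)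
           (filtercomap cmod (at_left 1))"
    and e: "0 < e"
  obtains K where "0 \<le> K" "\<beta> = 1 \<Longrightarrow> K = 0"
    "\<And>z. z \<in> ball 0 1 \<Longrightarrow> cmod (deriv \<phi> z) * norm (\<psi> z) \<le> e * (1 - cmod z) powr (\<beta> - 1) + K"
proof -
  have hol': "deriv \<phi> holomorphic_on ball 0 1"
    by (rule holomorphic_deriv[OF hol]) simp
  have "\<forall>\<^sub>F z in filtercomap cmod (at_left 1).
      norm ((1 - (cmod z)\<^sup>2) powr (1 - \<beta>) *\<^sub>R (deriv \<phi> z *\<^sub>C \<psi> z)) < e"
    using lim e by (auto simp: tendsto_iff)
  then obtain \<rho> where r: "\<rho> < 1" and near0: "\<And>z. \<rho> < cmod z \<Longrightarrow> cmod z < 1 \<Longrightarrow>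
      norm ((1 - (cmod z)\<^sup>2) powr (1 - \<beta>) *\<^sub>R (deriv \<phi> z *\<^sub>C \<psi> z)) < e"
    unfolding eventually_filtercomap eventually_at_left_field by blast
  have near: "cmod (deriv \<phi> z) * norm (\<psi> z) \<le> e * (1 - cmod z) powr (\<beta> - 1)"
    if z: "\<rho> < cmod z" "cmod z < 1" for z
  proof -
    define q where "q = 1 - (cmod z)\<^sup>2"
    have q: "1 - cmod z \<le> q" "0 < q"
      using z by (auto simp: q_def power2_eq_square mult_left_le_one_le mult_less_le_imp_less)
        (metis mult_strict_mono' mult_1 norm_ge_zero)
    have "q powr (1 - \<beta>) * (cmod (deriv \<phi> z) * norm (\<psi> z)) \<le> e"
      using near0[OF z] by (simp add: q_def norm_scaleC)
    then have "cmod (deriv \<phi> z) * norm (\<psi> z) \<le> e / q powr (1 - \<beta>)"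
      using q by (simp add: field_simps)
    also have "\<dots> = e * q powr (\<beta> - 1)"
      using powr_minus_divide[of q "1 - \<beta>"] by simp
    also have "\<dots> \<le> e * (1 - cmod z) powr (\<beta> - 1)"
      using e q z b by (intro mult_left_mono powr_mono2') auto
    finally show ?thesis .
  qed
  show ?thesis
  proof (cases "\<beta> = 1")
    case True
    obtain c where c: "\<And>z. z \<in> ball 0 1 \<Longrightarrow> \<psi> z = c"
      using little_lip_one_constant[of \<psi>] psi True by blast
    have "cmod (deriv \<phi> z) * norm c \<le> e" if z: "z \<in> ball 0 1" for z
    proof (cases "c = 0")
      case False
      \<comment> \<open>A circle outside \<open>z\<close> on which the boundary estimate already holds.\<close>
      define r where "r = (max (cmod z) \<rho> + 1) / 2"
      have rr: "cmod z < r" "\<rho> < r" "r < 1" "0 < r"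
        using z r norm_ge_zero[of z] by (auto simp: r_def simp del: norm_ge_zero)
      have "cmod (deriv \<phi> z) \<le> e / norm c"
      proof (rule maximum_modulus_frontier[of "deriv \<phi>" "cball 0 r"])
        show "deriv \<phi> holomorphic_on interior (cball 0 r)"
          using rr by (intro holomorphic_on_subset[OF hol']) auto
        show "continuous_on (closure (cball 0 r)) (deriv \<phi>)"
          using rr by (intro continuous_on_subset[OF holomorphic_on_imp_continuous_on[OF hol']]) auto
        show "cmod (deriv \<phi> y) \<le> e / norm c" if "y \<in> frontier (cball 0 r)" for y
        proof -
          have y: "cmod y = r" using that rr by simp
          then show ?thesis using near[of y] c[of y] rr False True by (simp add: field_simps)
        qed
      qed (use rr in auto)
      then show ?thesis using False by (simp add: field_simps)
    qed (use e in simp)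
    then show ?thesis using that[of 0] c True by auto
  next
    case False
    have cpt: "compact ((\<lambda>z. cmod (deriv \<phi> z) * norm (\<psi> z)) ` cball 0 \<rho>)"
    proof (rule compact_continuous_image)
      have "continuous_on (ball 0 1) \<psi>"
        using psi by (auto simp: little_lip_space_def lip_space_def intro: disk_analytic_continuous_on)
      then have "continuous_on (ball 0 1) (\<lambda>z. cmod (deriv \<phi> z) * norm (\<psi> z))"
        by (intro continuous_intros holomorphic_on_imp_continuous_on[OF hol'])
      then show "continuous_on (cball 0 \<rho>) (\<lambda>z. cmod (deriv \<phi> z) * norm (\<psi> z))"
        using r by (elim continuous_on_subset) auto
    qed simp
    then obtain K where K: "\<And>z. z \<in> cball 0 \<rho> \<Longrightarrow> cmod (deriv \<phi> z) * norm (\<psi> z) \<le> K"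
      using bounded_imp_bdd_above[OF compact_imp_bounded[OF cpt]] unfolding bdd_above_def by blast
    show ?thesis
    proof (rule that[of "\<bar>K\<bar>"])
      fix z :: complex assume z: "z \<in> ball 0 1"
      have "0 \<le> e * (1 - cmod z) powr (\<beta> - 1)" using e by simp
      then show "cmod (deriv \<phi> z) * norm (\<psi> z) \<le> e * (1 - cmod z) powr (\<beta> - 1) + \<bar>K\<bar>"
        using K[of z] near[of z] z by (cases "cmod z \<le> \<rho>") auto
    qed (use False in auto)
  qed
qed

text \<open>If \<open>\<parallel>\<psi> w\<parallel> \<le> \<eta> d\<^sup>\<beta>\<close>, then \<open>\<bar>\<phi> z - \<phi> w\<bar> \<le> 2\<close> is enough. Otherwise \<open>\<psi>\<close> changes by less than
  \<open>\<parallel>\<psi> w\<parallel> / 2\<close> within distance \<open>2 d\<close> of \<open>w\<close>, so dividing the bound for \<open>\<phi>' \<psi>\<close> by \<open>\<parallel>\<psi> w\<parallel> / 2\<close> bounds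
  \<open>\<phi>'\<close> there, and the factor \<open>\<parallel>\<psi> w\<parallel>\<close> cancels after integration.\<close>

lemma multiplier_times_symbol_difference:
  fixes \<psi> :: "complex \<Rightarrow> 'a::complex_normed_vector"
  assumes hol: "\<phi> holomorphic_on ball 0 1" and into: "\<phi> ` ball 0 1 \<subseteq> ball 0 1"
    and psi: "\<psi> \<in> little_lip_space \<beta>" and b: "0 < \<beta>" "\<beta> \<le> 1"
    and lim: "((\<lambda>z. (1 - (cmod z)\<^sup>2) powr (1 - \<beta>) *\<^sub>R (deriv \<phi> z *\<^sub>C \<psi> z)) \<longlongrightarrow> 0)
           (filtercomap cmod (at_left 1))"
    and e: "0 < e"
  obtains \<delta> where "0 < \<delta>" "\<And>z w. z \<in> ball 0 1 \<Longrightarrow> w \<in> ball 0 1 \<Longrightarrow> cmod (z - w) < \<delta> \<Longrightarrow>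
    norm (\<psi> w) * cmod (\<phi> z - \<phi> w) \<le> e * cmod (z - w) powr \<beta>"
proof -
  \<comment> \<open>The two cases below cost \<open>2 \<eta>\<close> and \<open>(16 / \<beta> + 1) \<eta>\<close>.\<close>
  define \<eta> where "\<eta> = e / (16 / \<beta> + 2)"
  have den: "0 < 16 / \<beta> + 2" using b by (simp add: add_pos_pos)
  have eta: "0 < \<eta>" using e den by (simp add: \<eta>_def)
  have eta_e: "(16 / \<beta> + 2) * \<eta> = e" using den by (simp add: \<eta>_def)
  have eta2: "2 * \<eta> \<le> e" "16 / \<beta> * \<eta> + \<eta> \<le> e"
    using eta_e eta b by (auto simp: distrib_right)
  obtain K where K: "0 \<le> K" "\<beta> = 1 \<Longrightarrow> K = 0"
    and KB: "\<And>z. z \<in> ball 0 1 \<Longrightarrow> cmod (deriv \<phi> z) * norm (\<psi> z) \<le> \<eta> * (1 - cmod z) powr (\<beta> - 1) + K"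
    using boundary_limit_global_bound[OF hol psi b(2) lim eta] by blast
  have "0 < \<eta> / 4" using eta by simp
  then obtain \<delta>1 where d1: "0 < \<delta>1" and small: "\<And>z w. z \<in> ball 0 1 \<Longrightarrow> w \<in> ball 0 1 \<Longrightarrow>
      cmod (z - w) < \<delta>1 \<Longrightarrow> norm (\<psi> z - \<psi> w) \<le> \<eta> / 4 * cmod (z - w) powr \<beta>"
    using psi unfolding little_lip_space_iff by metis
  \<comment> \<open>Below this distance the linear term \<open>K d\<close> is absorbed by \<open>\<eta> d\<^sup>\<beta>\<close>, as \<open>d = d powr (1 - \<beta>) * d powr \<beta>\<close>.\<close>
  obtain \<delta>2 where d2: "0 < \<delta>2" and lin: "\<And>d. 0 < d \<Longrightarrow> d < \<delta>2 \<Longrightarrow> 4 * K * d \<le> \<eta> * d powr \<beta>"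
  proof (cases "\<beta> = 1")
    case True
    then show ?thesis using that[of 1] K eta by simp
  next
    case False
    define \<delta>2 where "\<delta>2 = (\<eta> / (4 * K + 1)) powr (1 / (1 - \<beta>))"
    have "0 < \<delta>2" using eta K by (simp add: \<delta>2_def)
    moreover have "4 * K * d \<le> \<eta> * d powr \<beta>" if d: "0 < d" "d < \<delta>2" for d
    proof -
      have "d powr (1 - \<beta>) \<le> \<delta>2 powr (1 - \<beta>)" using d b by (intro powr_mono2) auto
      also have "\<dots> = \<eta> / (4 * K + 1)"
        using False eta K by (simp add: \<delta>2_def powr_powr)
      finally have "(4 * K + 1) * d powr (1 - \<beta>) \<le> \<eta>" using K by (simp add: field_simps)
      then have "4 * K * d powr (1 - \<beta>) \<le> \<eta>" 
        using powr_ge_zero[of d "1 - \<beta>"] unfolding distrib_right by linarith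
      then have "4 * K * d powr (1 - \<beta>) * d powr \<beta> \<le> \<eta> * d powr \<beta>"
        by (intro mult_right_mono) auto
      moreover have "d powr (1 - \<beta>) * d powr \<beta> = d" using d by (simp flip: powr_add)
      ultimately show ?thesis by (simp add: mult.assoc)
    qed
    ultimately show ?thesis using that by blast
  qed
  show ?thesis
  proof (rule that[of "min (\<delta>1 / 2) \<delta>2"])
    fix z w :: complex
    assume z: "z \<in> ball 0 1" and w: "w \<in> ball 0 1" and zw: "cmod (z - w) < min (\<delta>1 / 2) \<delta>2"
    define d where "d = cmod (z - w)"
    define N where "N = norm (\<psi> w)"
    show "norm (\<psi> w) * cmod (\<phi> z - \<phi> w) \<le> e * cmod (z - w) powr \<beta>"
    proof (cases "N \<le> \<eta> * d powr \<beta>")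
      case True
      have "\<phi> z \<in> ball 0 1" "\<phi> w \<in> ball 0 1" using into z w by blast+
      then have "cmod (\<phi> z - \<phi> w) \<le> 2"
        using norm_triangle_ineq4[of "\<phi> z" "\<phi> w"] by simp
      then have "N * cmod (\<phi> z - \<phi> w) \<le> (\<eta> * d powr \<beta>) * 2"
        using True eta by (intro mult_mono) auto
      also have "\<dots> \<le> e * d powr \<beta>"
        using mult_right_mono[OF eta2(1), of "d powr \<beta>"] by (simp add: mult_ac)
      finally show ?thesis by (simp add: N_def d_def)
    next
      case False
      have N: "0 < N" using False eta by (smt (verit) mult_nonneg_nonneg powr_ge_zero)
      have deriv_bound: "cmod (deriv \<phi> \<zeta>) \<le> (2 * \<eta> / N) * (1 - cmod \<zeta>) powr (\<beta> - 1) + 2 * K / N"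
        if zeta: "\<zeta> \<in> ball 0 1" "cmod (\<zeta> - w) \<le> 2 * cmod (z - w)" for \<zeta>
      proof -
        \<comment> \<open>The factor \<open>\<eta> / 4\<close> leaves room for the enlarged radius: \<open>(2 d)\<^sup>\<beta> \<le> 2 d\<^sup>\<beta>\<close>.\<close>
        have "cmod (\<zeta> - w) powr \<beta> \<le> (2 * d) powr \<beta>"
          using zeta b by (intro powr_mono2) (auto simp: d_def)
        also have "\<dots> \<le> 2 * d powr \<beta>"
          using powr_mono[of \<beta> 1 2] b by (simp add: powr_mult d_def mult_right_mono)
        finally have "\<eta> / 4 * cmod (\<zeta> - w) powr \<beta> \<le> \<eta> / 4 * (2 * d powr \<beta>)"
          using eta by (intro mult_left_mono) auto
        then have "norm (\<psi> \<zeta> - \<psi> w) \<le> N / 2"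
          using small[OF zeta(1) w] zeta(2) zw False by simp
        then have "N / 2 \<le> norm (\<psi> \<zeta>)"
          using norm_triangle_ineq2[of "\<psi> w" "\<psi> \<zeta>"] by (simp add: N_def norm_minus_commute)
        then have "cmod (deriv \<phi> \<zeta>) * (N / 2) \<le> cmod (deriv \<phi> \<zeta>) * norm (\<psi> \<zeta>)"
          by (intro mult_left_mono) auto
        also note KB[OF zeta(1)]
        finally show ?thesis using N by (simp add: field_simps)
      qed
      have "cmod (\<phi> z - \<phi> w) \<le> 8 * (2 * \<eta> / N) / \<beta> * cmod (z - w) powr \<beta> + 2 * (2 * K / N) * cmod (z - w)"
        using eta N by (intro Hardy_Littlewood_local[OF hol b _ z w deriv_bound]) auto
      then have "N * cmod (\<phi> z - \<phi> w) \<le> N * (8 * (2 * \<eta> / N) / \<beta> * d powr \<beta> + 2 * (2 * K / N) * d)"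
        using N by (intro mult_left_mono) (auto simp: d_def)
      also have "\<dots> = 16 / \<beta> * \<eta> * d powr \<beta> + 4 * K * d"
        using N b by (simp add: field_simps)
      also have "4 * K * d \<le> \<eta> * d powr \<beta>"
        using lin[of d] zw by (cases "z = w") (auto simp: d_def)
      also have "16 / \<beta> * \<eta> * d powr \<beta> + \<eta> * d powr \<beta> \<le> e * d powr \<beta>"
        using mult_right_mono[OF eta2(2), of "d powr \<beta>"] by (simp add: distrib_right)
      finally show ?thesis by (simp add: N_def d_def)
    qed
  qed (use d1 d2 in simp)
qed

section \<open>Weighted composition operators on the little Lipschitz spaces\<close>

lemma clinop_apply_diff_left: "clinop_apply (S - T) x = clinop_apply S x - clinop_apply T x"
  by transfer (simp add: minus_blinfun.rep_eq)

lemma clinop_apply_diff_right: "clinop_apply T (x - y) = clinop_apply T x - clinop_apply T y"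
  by transfer (simp add: blinfun.diff_right)

lemma wcomp_lipschitz_vanishing:
  fixes \<psi> :: "complex \<Rightarrow> ('a::complex_normed_vector, 'b::complex_normed_vector) clinop"
  assumes psi: "\<psi> \<in> little_lip_space \<beta>" and into: "\<phi> ` ball 0 1 \<subseteq> ball 0 1"
    and mult: "\<And>e. 0 < e \<Longrightarrow> \<exists>d>0. \<forall>z\<in>ball 0 1. \<forall>w\<in>ball 0 1. cmod (z - w) < d \<longrightarrow>
      norm (\<psi> w) * cmod (\<phi> z - \<phi> w) \<le> e * cmod (z - w) powr \<beta>"
    and M: "\<And>u. u \<in> ball 0 1 \<Longrightarrow> norm (g u) \<le> M"
    and L: "0 \<le> L" "\<And>u v. u \<in> ball 0 1 \<Longrightarrow> v \<in> ball 0 1 \<Longrightarrow> norm (g u - g v) \<le> L * cmod (u - v)"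
    and e: "0 < e"
  shows "\<exists>d>0. \<forall>z\<in>ball 0 1. \<forall>w\<in>ball 0 1. cmod (z - w) < d \<longrightarrow>
    norm (wcomp \<psi> \<phi> g z - wcomp \<psi> \<phi> g w) \<le> e * cmod (z - w) powr \<beta>"
proof -
  have M0: "0 \<le> M" using M[of 0] norm_ge_zero[of "g 0"] by (simp del: norm_ge_zero)
  define a where "a = e / (2 * (M + 1))"
  define b where "b = e / (2 * (L + 1))"
  have ab: "0 < a" "0 < b" using e M0 L by (auto simp: a_def b_def)
  have Ma: "M * a \<le> e / 2" and Lb: "L * b \<le> e / 2"
    using e M0 L by (auto simp: a_def b_def field_simps)
  obtain d1 where d1: "0 < d1" "\<And>z w. z \<in> ball 0 1 \<Longrightarrow> w \<in> ball 0 1 \<Longrightarrow> cmod (z - w) < d1 \<Longrightarrow>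
      norm (\<psi> z - \<psi> w) \<le> a * cmod (z - w) powr \<beta>"
    using psi ab(1) unfolding little_lip_space_iff by metis
  obtain d2 where d2: "0 < d2" "\<And>z w. z \<in> ball 0 1 \<Longrightarrow> w \<in> ball 0 1 \<Longrightarrow> cmod (z - w) < d2 \<Longrightarrow>
      norm (\<psi> w) * cmod (\<phi> z - \<phi> w) \<le> b * cmod (z - w) powr \<beta>"
    using mult[OF ab(2)] by metis
  show ?thesis
  proof (intro exI[of _ "min d1 d2"] conjI ballI impI)
    fix z w :: complex
    assume z: "z \<in> ball 0 1" and w: "w \<in> ball 0 1" and zw: "cmod (z - w) < min d1 d2"
    define p where "p = cmod (z - w) powr \<beta>"
    have p: "0 \<le> p" by (simp add: p_def)
    have phi: "\<phi> z \<in> ball 0 1" "\<phi> w \<in> ball 0 1" using into z w by blast+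
    have "wcomp \<psi> \<phi> g z - wcomp \<psi> \<phi> g w =
        clinop_apply (\<psi> z - \<psi> w) (g (\<phi> z)) + clinop_apply (\<psi> w) (g (\<phi> z) - g (\<phi> w))"
      by (simp add: wcomp_def clinop_apply_diff_left clinop_apply_diff_right)
    then have "norm (wcomp \<psi> \<phi> g z - wcomp \<psi> \<phi> g w) \<le>
        norm (clinop_apply (\<psi> z - \<psi> w) (g (\<phi> z))) + norm (clinop_apply (\<psi> w) (g (\<phi> z) - g (\<phi> w)))"
      by (simp add: norm_triangle_ineq)
    also have "norm (clinop_apply (\<psi> z - \<psi> w) (g (\<phi> z))) \<le> (a * p) * M"
      using d1(2)[OF z w] zw M[OF phi(1)] ab p
      by (intro order_trans[OF norm_clinop_apply] mult_mono) (auto simp: p_def)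
    also have "norm (clinop_apply (\<psi> w) (g (\<phi> z) - g (\<phi> w))) \<le> L * (b * p)"
    proof -
      have "norm (clinop_apply (\<psi> w) (g (\<phi> z) - g (\<phi> w))) \<le> norm (\<psi> w) * (L * cmod (\<phi> z - \<phi> w))"
        by (intro order_trans[OF norm_clinop_apply] mult_left_mono L(2) phi) auto
      also have "\<dots> = L * (norm (\<psi> w) * cmod (\<phi> z - \<phi> w))" by simp
      also have "\<dots> \<le> L * (b * p)"
        using d2(2)[OF z w] zw L by (intro mult_left_mono) (auto simp: p_def)
      finally show ?thesis .
    qed
    also have "a * p * M + L * (b * p) \<le> e * p"
      using mult_right_mono[OF Ma p] mult_right_mono[OF Lb p] by (simp add: mult_ac)
    finally show "norm (wcomp \<psi> \<phi> g z - wcomp \<psi> \<phi> g w) \<le> e * cmod (z - w) powr \<beta>"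
      by (simp add: p_def)
  qed (use d1 d2 in simp)
qed

theorem theorem3p1:
  fixes \<phi> :: "complex \<Rightarrow> complex"
    and \<psi> :: "complex \<Rightarrow> ('a::complex_banach, 'b::complex_banach) clinop"
    and \<alpha> \<beta> :: real
  assumes "\<alpha> \<in> {0<..1}" and "\<beta> \<in> {0<..1}"
    and "\<phi> holomorphic_on ball 0 1" and "\<phi> ` ball 0 1 \<subseteq> ball 0 1"
    and "disk_analytic \<psi>"
    and "bounded_op \<alpha> (lip_space \<alpha>) \<beta> (lip_space \<beta>) (wcomp \<psi> \<phi>)"
    and "\<psi> \<in> little_lip_space \<beta>"
    and "((\<lambda>z. (1 - (cmod z)\<^sup>2) powr (1 - \<beta>) *\<^sub>R (deriv \<phi> z *\<^sub>C \<psi> z)) \<longlongrightarrow> 0)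
           (filtercomap cmod (at_left 1))"
  shows "bounded_op \<alpha> (little_lip_space \<alpha>) \<beta> (little_lip_space \<beta>) (wcomp \<psi> \<phi>)"
proof -
  have a: "0 < \<alpha>" and b: "0 < \<beta>" "\<beta> \<le> 1" using assms by auto
  obtain C where W_in: "\<And>f. f \<in> lip_space \<alpha> \<Longrightarrow> wcomp \<psi> \<phi> f \<in> lip_space \<beta>"
    and C: "\<And>f. f \<in> lip_space \<alpha> \<Longrightarrow> lip_norm \<beta> (wcomp \<psi> \<phi> f) \<le> C * lip_norm \<alpha> f"
    using assms(6) unfolding bounded_op_def by blast
  have mult: "\<exists>d>0. \<forall>z\<in>ball 0 1. \<forall>w\<in>ball 0 1. cmod (z - w) < d \<longrightarrow>
      norm (\<psi> w) * cmod (\<phi> z - \<phi> w) \<le> e * cmod (z - w) powr \<beta>" if "0 < e" for e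
    using multiplier_times_symbol_difference[OF assms(3,4,7) b assms(8) that] by metis
  have "wcomp \<psi> \<phi> f \<in> little_lip_space \<beta>" if f: "f \<in> little_lip_space \<alpha>" for f
    unfolding little_lip_space_iff
  proof (intro conjI allI impI)
    have fl: "f \<in> lip_space \<alpha>" using f by (simp add: little_lip_space_def)
    then show "wcomp \<psi> \<phi> f \<in> lip_space \<beta>" by (rule W_in)
    fix e :: real assume e: "0 < e"
    \<comment> \<open>The term \<open>+ 1\<close> avoids a division by zero, and \<open>\<bar>C\<bar>\<close> replaces \<open>C\<close>, whose sign is not known.\<close>
    define e1 where "e1 = e / (2 * (\<bar>C\<bar> + 1))"
    have e1: "0 < e1" using e by (simp add: e1_def add_pos_nonneg)
    have Ce1: "\<bar>C\<bar> * e1 \<le> e / 2" using e by (simp add: e1_def field_simps)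
    obtain r where r: "0 < r" "r < 1"
      and hl: "(\<lambda>z. f z - f (of_real r * z)) \<in> lip_space \<alpha>"
      and hn: "lip_norm \<alpha> (\<lambda>z. f z - f (of_real r * z)) \<le> e1"
      using little_lip_dilation_approx[OF a f e1] by metis
    define g where "g z = f (of_real r * z)" for z
    define h where "h z = f z - g z" for z
    have h: "h \<in> lip_space \<alpha>" "lip_norm \<alpha> h \<le> e1"
      using hl hn by (auto simp: h_def[abs_def] g_def)
    have "C * lip_norm \<alpha> h \<le> \<bar>C\<bar> * e1"
      using h lip_norm_nonneg[OF _ h(1)] a by (intro mult_mono) auto
    then have Wh: "lip_norm \<beta> (wcomp \<psi> \<phi> h) \<le> e / 2" using C[OF h(1)] Ce1 by linarith
    obtain M where M: "\<And>z. z \<in> ball 0 1 \<Longrightarrow> norm (f z) \<le> M"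
      using lip_space_bounded[OF _ fl] a by (metis less_imp_le)
    have gM: "norm (g z) \<le> M" if "z \<in> ball 0 1" for z
      unfolding g_def using that r
      by (intro M) (simp add: norm_mult, smt (verit) mult_left_le_one_le norm_ge_zero)
    have an: "disk_analytic f" using fl by (simp add: lip_space_def)
    have "\<exists>L\<ge>0. \<forall>u\<in>ball 0 1. \<forall>v\<in>ball 0 1. norm (g u - g v) \<le> L * cmod (u - v)"
      unfolding g_def by (rule disk_analytic_dilation_lipschitz[OF an _ r]) (rule M)
    then obtain L where L0: "0 \<le> L" and L: "\<And>u v. u \<in> ball 0 1 \<Longrightarrow> v \<in> ball 0 1 \<Longrightarrow>
        norm (g u - g v) \<le> L * cmod (u - v)"
      by blast
    have "\<exists>d>0. \<forall>z\<in>ball 0 1. \<forall>w\<in>ball 0 1. cmod (z - w) < d \<longrightarrow>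
        norm (wcomp \<psi> \<phi> g z - wcomp \<psi> \<phi> g w) \<le> e / 2 * cmod (z - w) powr \<beta>"
      by (rule wcomp_lipschitz_vanishing[OF assms(7,4) mult _ L0 _ half_gt_zero[OF e]])
        (rule gM L | assumption)+
    then obtain d where d: "0 < d" and Wg: "\<And>z w. z \<in> ball 0 1 \<Longrightarrow> w \<in> ball 0 1 \<Longrightarrow> cmod (z - w) < d \<Longrightarrow>
        norm (wcomp \<psi> \<phi> g z - wcomp \<psi> \<phi> g w) \<le> e / 2 * cmod (z - w) powr \<beta>"
      by blast
    show "\<exists>d>0. \<forall>z\<in>ball 0 1. \<forall>w\<in>ball 0 1. cmod (z - w) < d \<longrightarrow>
        norm (wcomp \<psi> \<phi> f z - wcomp \<psi> \<phi> f w) \<le> e * cmod (z - w) powr \<beta>"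
    proof (intro exI[of _ d] conjI ballI impI)
      fix z w :: complex
      assume z: "z \<in> ball 0 1" and w: "w \<in> ball 0 1" and zw: "cmod (z - w) < d"
      have split: "wcomp \<psi> \<phi> f x = wcomp \<psi> \<phi> h x + wcomp \<psi> \<phi> g x" for x
        by (simp add: wcomp_def h_def clinop_apply_diff_right)
      have "norm (wcomp \<psi> \<phi> h z - wcomp \<psi> \<phi> h w) \<le> lip_norm \<beta> (wcomp \<psi> \<phi> h) * cmod (z - w) powr \<beta>"
        using b by (intro lip_norm_diff_bound W_in h z w) auto
      also have "\<dots> \<le> e / 2 * cmod (z - w) powr \<beta>"
        using Wh by (intro mult_right_mono) auto
      finally have "norm (wcomp \<psi> \<phi> h z - wcomp \<psi> \<phi> h w) + norm (wcomp \<psi> \<phi> g z - wcomp \<psi> \<phi> g w)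
          \<le> e * cmod (z - w) powr \<beta>"
        using Wg[OF z w zw] by simp
      then show "norm (wcomp \<psi> \<phi> f z - wcomp \<psi> \<phi> f w) \<le> e * cmod (z - w) powr \<beta>"
        unfolding split add_diff_add by (rule order_trans[OF norm_triangle_ineq])
    qed (rule d)
  qed
  moreover have "little_lip_space \<alpha> \<subseteq> (lip_space \<alpha> :: (complex \<Rightarrow> 'a) set)"
    by (auto simp: little_lip_space_def)
  ultimately show ?thesis
    unfolding bounded_op_def using C by blast
qed

end
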